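(* Let $D:=\{z\in\mathbb{C}:|z|<1\}$ and $D_r:=\{z\in\mathbb{C}:|z|\le r\}$ with $0<r<1$. Then $$d\sigma_{D_r}^D(z)=\frac{r(1-r^2)(1-|z|^2)}{2\pi|z|(r|z|+1)^2(r+|z|)^2}\,dx\,dy,\quad z=x+iy\in D,$$ and $$\sigma_{D_r}^D(D)=\frac{1-r}{1+r}<1.$$ Furthermore, whenever $\nu_k$, $k=1,\ldots,m$, are positive Borel measures compactly supported in $D$ such that the total mass of $\sum_{k=1}^m\nu_k$ is equal to $1$, the inequality $$\sum_{k=1}^m\inf_{D_r}U_D^{\nu_k}\ \ge\ C_{D_r}^D+\sigma_{D_r}^D(D)\,\inf_{D_r}\sum_{k=1}^m U_D^{\nu_k}$$ holds, where the constant $$C_{D_r}^D:=\int\inf_{z\in D_r}g_D(z,\zeta)\,d\mu_{D_r}^D(\zeta)-V_{D_r}^D\,\sigma_{D_r}^D(D)$$ is given by $$C_{D_r}^D=\log\frac{1+r^2}{2r}+\frac{1-r}{1+r}\log r.$$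
   Context: $g_D(z,\zeta)=\log\left|\frac{1-\bar\zeta z}{z-\zeta}\right|$ is the Green function of the unit disk $D$. For a positive Borel measure $\nu$ with compact support in $D$, its Green potential is $U_D^{\nu}(z):=\int g_D(z,\zeta)\,d\nu(\zeta)$, $z\in D$. For a compact set $E\subset D$ of positive logarithmic capacity, $V_E^D$ denotes the minimum Green energy $\inf_\mu\iint g_D(z,\zeta)\,d\mu(z)\,d\mu(\zeta)$ over all positive unit Borel measures $\mu$ supported on $E$, and $\mu_E^D$ (the Green equilibrium measure of $E$) is the unique such measure attaining the minimum. The measure $\sigma_E^D$ is the positive Borel measure on $D$ (the Riesz measure of the superharmonic function $z\mapsto\inf_{\zeta\in E}g_D(z,\zeta)$) for which $\inf_{\zeta\in E}g_D(z,\zeta)=\int g_D(z,\zeta)\,d\sigma_E^D(\zeta)$ for all $z\in D$. *)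

theory Defs
  imports "HOL-Analysis.Analysis"
begin

abbreviation unit_disk :: "complex set" where
  "unit_disk \<equiv> ball 0 1"

text \<open>The Green function of the unit disk is nonnegative on the disk and equals infinity on the
  diagonal, so it takes values in \<^typ>\<open>ennreal\<close>. Since \<^term>\<open>ennreal\<close> truncates negative
  numbers, it is meaningful only for arguments in the disk.\<close>

definition green :: "complex \<Rightarrow> complex \<Rightarrow> ennreal" where
  "green z w = (if z = w then \<infinity> else ennreal (ln (cmod ((1 - cnj w * z) / (z - w)))))"

text \<open>Positive Borel measures on the disk; their underlying space is the disk itself.\<close>

definition disk_measure :: "complex measure \<Rightarrow> bool" where
  "disk_measure M \<longleftrightarrow> sets M = sets (restrict_space borel unit_disk)"

definition compactly_supported :: "complex measure \<Rightarrow> bool" where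
  "compactly_supported M \<longleftrightarrow>
     (\<exists>K. compact K \<and> K \<subseteq> unit_disk \<and> emeasure M (unit_disk - K) = 0)"

definition green_potential :: "complex measure \<Rightarrow> complex \<Rightarrow> ennreal" where
  "green_potential M z = (\<integral>\<^sup>+ w. green z w \<partial>M)"

definition green_energy :: "complex measure \<Rightarrow> ennreal" where
  "green_energy M = (\<integral>\<^sup>+ w. (\<integral>\<^sup>+ z. green z w \<partial>M) \<partial>M)"

definition unit_measures_on :: "complex set \<Rightarrow> complex measure set" where
  "unit_measures_on E =
     {M. disk_measure M \<and> emeasure M unit_disk = 1 \<and> emeasure M (unit_disk - E) = 0}"

definition min_green_energy :: "complex set \<Rightarrow> ennreal" where
  "min_green_energy E = (INF M \<in> unit_measures_on E. green_energy M)"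

text \<open>The next two definite descriptions are meant for compact \<open>E\<close> of positive logarithmic
  capacity contained in the disk, where the described measures exist and are unique.\<close>

definition green_equilibrium :: "complex set \<Rightarrow> complex measure" where
  "green_equilibrium E =
     (THE M. M \<in> unit_measures_on E \<and> green_energy M = min_green_energy E)"

definition sigma_green :: "complex set \<Rightarrow> complex measure" where
  "sigma_green E =
     (THE M. disk_measure M \<and>
        (\<forall>z\<in>unit_disk. (INF w\<in>E. green z w) = (\<integral>\<^sup>+ w. green z w \<partial>M)))"

text \<open>The constant may be negative, hence the passage to \<^typ>\<open>ereal\<close>.\<close>

definition green_constant :: "complex set \<Rightarrow> ereal" where
  "green_constant E =
     enn2ereal (\<integral>\<^sup>+ w. (INF z\<in>E. green z w) \<partial>green_equilibrium E)
     - enn2ereal (min_green_energy E) * enn2ereal (emeasure (sigma_green E) unit_disk)"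

end

theory Submission
  imports Defs "HOL-Complex_Analysis.Complex_Analysis"
begin

text \<open>Write \<open>g\<close> for the Green function of the unit disc, \<open>P q = (1 - |q|\<^sup>2) / |1 - q|\<^sup>2\<close> for the Poisson
  kernel, and \<open>p t = ln ((1 + r t) / (t + r))\<close>. Everything follows from one formula. The Green function
  of the disc of radius \<open>x\<close> grows with \<open>x\<close> at the rate \<open>P (z \<cdot> cnj w / x\<^sup>2) / x\<close>, so that

    \<open>g z w = \<integral> P (z \<cdot> cnj w / x\<^sup>2) / x dx\<close>  over  \<open>max |z| |w| < x < 1\<close>   (\<open>green_hadamard\<close>).

  The formula includes the diagonal, where both sides are infinite, and all its terms are non-negative, so
  that Tonelli's theorem applies throughout. It has three consequences.

  The mean of \<open>P\<close> over a circle about the origin inside the disc is 1. Hence the mean of \<open>g z\<close> over the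
  circle of radius \<open>t\<close> is \<open>ln (1 / max |z| t)\<close> (\<open>green_circle_mean\<close>, \<open>nn_integral_inverse\<close>). By
  Moebius invariance, the means of a potential over hyperbolic circles about any centre \<open>a\<close> are integrals
  of \<open>ln (1 / max \<rho> \<delta>)\<close>, where \<open>\<delta>\<close> is the pseudohyperbolic distance to \<open>a\<close>. The difference of the means for
  \<open>\<rho>\<close> and \<open>2\<rho>\<close> integrates a bounded bump at \<open>a\<close> of size \<open>\<rho>\<close>. These bumps form an approximate identity
  as \<open>\<rho>\<close> tends to 0, so a bounded potential determines its measure (\<open>green_potential_inject\<close>).

  The reproducing property of \<open>P\<close> splits the integrand as a circle mean of products of two Poisson
  kernels. So \<open>g z w\<close> is an \<open>L\<^sup>2\<close> inner product of non-negative features of \<open>z\<close> and \<open>w\<close>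
  (\<open>green_eq_feature_product\<close>), and the energy of a measure is the squared norm of its mean feature. The
  uniform measure on the circle of radius \<open>r\<close> has potential \<open>ln (1 / r)\<close> on the disc \<open>|z| \<le> r\<close>, hence the same inner product
  \<open>ln (1 / r)\<close> with every unit measure there, including itself. It is therefore the vector of minimal norm
  (\<open>energy_ge_and_rigidity\<close>); another minimiser would have the same mean feature, the same potential,
  and so would be the same measure.

  By the triangle inequality for the pseudohyperbolic distance, the infimum of \<open>g z\<close> over the disc of radius \<open>r\<close> is \<open>p |z|\<close> (\<open>INF_green\<close>).
  Averaging over angles, the potential of a rotation invariant measure at \<open>z\<close> is the integral of
  \<open>mass of the disc of radius x / x\<close> over \<open>|z| < x < 1\<close>. The measure with the stated density gives the
  disc of radius \<open>x\<close> the mass \<open>- x p' x\<close>, and \<open>p 1 = 0\<close>, so its potential is \<open>p\<close>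
  (\<open>green_potential_riesz\<close>). Uniqueness identifies it with \<open>sigma_green\<close>, of total mass \<open>- p' 1 = (1 - r) / (1 + r)\<close>.

  For the inequality let \<open>\<nu>\<close> be the sum of the \<open>\<nu>\<^sub>k\<close>. The left-hand side is at least \<open>\<integral> p |w| d\<nu>\<close>. The infimum
  on the right is at most the mean of the potential of \<open>\<nu>\<close> over the circle of radius \<open>r\<close>, which is
  \<open>\<integral> ln (1 / max |w| r) d\<nu>\<close>. As \<open>\<nu>\<close> has mass 1, it remains to compare the two integrands for each
  \<open>w\<close>, and that is a one-variable inequality (\<open>green_inf_profile_ge\<close>).\<close>

section \<open>The Poisson kernel on the unit circle\<close>

lemma measurable_cnj [measurable]: "cnj \<in> borel_measurable borel"
  by (intro borel_measurable_continuous_onI continuous_intros)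

lemma measurable_cis [measurable]: "cis \<in> borel_measurable borel"
  by (intro borel_measurable_continuous_onI continuous_intros)

definition poisson :: "complex \<Rightarrow> real" where
  "poisson q = (1 - (cmod q)\<^sup>2) / (cmod (1 - q))\<^sup>2"

lemma poisson_measurable [measurable]: "poisson \<in> borel_measurable borel"
  unfolding poisson_def by measurable

lemma poisson_nonneg: "cmod q \<le> 1 \<Longrightarrow> 0 \<le> poisson q"
  by (simp add: poisson_def abs_square_le_1)

lemma poisson_cnj [simp]: "poisson (cnj q) = poisson q"
proof -
  have "cmod (1 - cnj q) = cmod (cnj (1 - q))" by simp
  then show ?thesis unfolding poisson_def by (simp only: complex_mod_cnj)
qed

lemma poisson_eq_Re: "q \<noteq> 1 \<Longrightarrow> poisson q = Re ((1 + q) / (1 - q))"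
  by (simp add: poisson_def complex_div_cnj[of "1 + q" "1 - q"] Re_divide_of_real cmod_power2)
     (simp add: power2_eq_square algebra_simps)

lemma one_minus_cnj_mult_neq_0:
  assumes "cmod a < 1" "cmod z \<le> 1"
  shows "1 - cnj a * z \<noteq> 0"
proof
  assume "1 - cnj a * z = 0"
  then have "cmod (cnj a * z) = 1" by (metis eq_iff_diff_eq_0 norm_one)
  moreover have "cmod (cnj a * z) \<le> cmod a * 1"
    unfolding norm_mult complex_mod_cnj using assms by (intro mult_left_mono) auto
  ultimately show False using assms by simp
qed

text \<open>Circles are parametrised by the fraction \<open>t\<close> of a full turn, so that means over circles are integrals
  against a probability measure.\<close>

definition turn :: "real measure" where "turn = uniform_measure lborel {0..1}"

abbreviation unit_pt :: "real \<Rightarrow> complex" where "unit_pt t \<equiv> cis (2 * pi * t)"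

lemma sets_turn [measurable_cong, simp]: "sets turn = sets borel"
  by (simp add: turn_def)

lemma space_turn [simp]: "space turn = UNIV"
  by (simp add: turn_def)

lemma emeasure_turn [simp]: "emeasure turn UNIV = 1"
  unfolding turn_def by (subst emeasure_uniform_measure) (auto simp: divide_ennreal_def)

lemma sigma_finite_turn: "sigma_finite_measure turn"
proof -
  interpret finite_measure turn by (rule finite_measureI) simp
  show ?thesis by unfold_locales
qed

lemma nn_integral_turn:
  assumes [measurable]: "f \<in> borel_measurable borel"
  shows "(\<integral>\<^sup>+t. f t \<partial>turn) = (\<integral>\<^sup>+t. f t * indicator {0..1} t \<partial>lborel)"
  unfolding turn_def by (simp add: nn_integral_uniform_measure divide_ennreal_def)

text \<open>On the unit circle \<open>P (w \<cdot> cnj u) = (1 - |w|\<^sup>2) / |u - w|\<^sup>2\<close>, which is \<open>u / (u - w)\<close> times the function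
  \<open>(1 - |w|\<^sup>2) / (1 - cnj w \<cdot> u)\<close>, holomorphic on the closed disc. The other factor \<open>P (z \<cdot> cnj u)\<close> is the real part of
  \<open>(1 + cnj z \<cdot> u) / (1 - cnj z \<cdot> u)\<close>, also holomorphic there. So the mean is the real part
  of a Cauchy integral evaluated at \<open>w\<close>.\<close>

lemma poisson_reproducing:
  assumes z: "cmod z < 1" and w: "cmod w < 1"
  shows "(\<integral>\<^sup>+t. ennreal (poisson (z * cnj (unit_pt t)) * poisson (w * cnj (unit_pt t))) \<partial>turn)
       = ennreal (poisson (z * cnj w))"
proof -
  note ne = one_minus_cnj_mult_neq_0
  \<comment> \<open>\<open>1 - w \<cdot> cnj w\<close> is the complex form of \<open>1 - |w|\<^sup>2\<close>; it makes \<open>f w\<close> collapse to its first factor.\<close>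
  define f where "f u = (1 + cnj z * u) / (1 - cnj z * u) * ((1 - w * cnj w) / (1 - cnj w * u))" for u
  have "f holomorphic_on cball 0 1"
    unfolding f_def using ne[OF z] ne[OF w] by (intro holomorphic_intros) auto
  then have "((\<lambda>u. f u / (u - w)) has_contour_integral (2 * of_real pi * \<i> * f w)) (circlepath 0 1)"
    using w by (intro Cauchy_integral_circlepath_simple) auto
  then have "((\<lambda>t. f (unit_pt t) / (unit_pt t - w) * (2 * pi * \<i> * unit_pt t)) has_integral
      (2 * of_real pi * \<i> * f w)) {0..1}"
    unfolding has_contour_integral_def
    by (rule has_integral_eq[rotated]) (simp add: vector_derivative_circlepath01, simp add: circlepath cis_conv_exp mult_ac)
  then have "((\<lambda>t. 1 / (2 * of_real pi * \<i>) * (f (unit_pt t) / (unit_pt t - w) * (2 * pi * \<i> * unit_pt t))) has_integral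
      1 / (2 * of_real pi * \<i>) * (2 * of_real pi * \<i> * f w)) {0..1}"
    by (rule has_integral_mult_right)
  then have "((Re \<circ> (\<lambda>t. f (unit_pt t) / (unit_pt t - w) * unit_pt t)) has_integral Re (f w)) {0..1}"
    by (intro has_integral_linear[OF _ bounded_linear_Re]) (simp add: field_simps)
  moreover have "Re (f u / (u - w) * u) = poisson (z * cnj u) * poisson (w * cnj u)" if u: "cmod u = 1" for u
  proof -
    have uu: "cnj u * u = 1" using u complex_norm_square[of u] by (simp add: mult.commute)
    have uw: "u - w \<noteq> 0" using u w by auto
    have "u / (u - w) * (1 / (1 - cnj w * u)) = 1 / ((u - w) * cnj (u - w))"
    proof -
      have "(u - w) * cnj (u - w) * u = (u - w) * (1 - cnj w * u)"
        using uu by (simp add: algebra_simps)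
      then have *: "cnj (u - w) * u = 1 - cnj w * u" using uw by simp
      have "u \<noteq> 0" using u by auto
      then show ?thesis unfolding *[symmetric] using uw by (simp add: divide_simps)
    qed
    also have "\<dots> = of_real (1 / (cmod (u - w))\<^sup>2)"
      by (simp only: complex_norm_square[symmetric] of_real_divide of_real_1)
    finally have 1: "u / (u - w) * (1 / (1 - cnj w * u)) = of_real (1 / (cmod (u - w))\<^sup>2)" .
    have "u - w = u * (1 - w * cnj u)" using uu by (simp add: algebra_simps)
    then have 2: "cmod (u - w) = cmod (1 - w * cnj u)" using u by (simp add: norm_mult)
    have 3: "cmod (w * cnj u) = cmod w" using u by (simp add: norm_mult)
    have "f u / (u - w) * u
        = (1 + cnj z * u) / (1 - cnj z * u) * (1 - w * cnj w) * (u / (u - w) * (1 / (1 - cnj w * u)))"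
      unfolding f_def by simp
    also have "\<dots> = (1 + cnj z * u) / (1 - cnj z * u) * of_real (poisson (w * cnj u))"
      unfolding 1 poisson_def 3 2 by (simp add: complex_norm_square[symmetric])
    finally have "Re (f u / (u - w) * u) = Re ((1 + cnj z * u) / (1 - cnj z * u)) * poisson (w * cnj u)"
      by (simp only: times_complex.sel Re_complex_of_real Im_complex_of_real)
    also have "Re ((1 + cnj z * u) / (1 - cnj z * u)) = poisson (cnj (z * cnj u))"
      using ne[OF z, of u] u by (subst poisson_eq_Re) auto
    finally show ?thesis by (simp only: poisson_cnj)
  qed
  moreover have "Re (f w) = poisson (z * cnj w)"
  proof -
    have "f w = (1 + cnj z * w) / (1 - cnj z * w)"
      unfolding f_def using ne[OF w, of w] w by (simp add: mult.commute)
    also have "Re \<dots> = poisson (cnj (z * cnj w))"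
      using ne[OF z, of w] w by (subst poisson_eq_Re) auto
    finally show ?thesis by (simp only: poisson_cnj)
  qed
  ultimately have "((\<lambda>t. poisson (z * cnj (unit_pt t)) * poisson (w * cnj (unit_pt t)))
      has_integral poisson (z * cnj w)) {0..1}"
    by (simp add: o_def)
  moreover have "0 \<le> poisson (z * cnj (unit_pt t)) * poisson (w * cnj (unit_pt t))" for t
    using z w by (intro mult_nonneg_nonneg poisson_nonneg) (auto simp: norm_mult)
  ultimately show ?thesis
    by (subst nn_integral_turn) (auto intro!: nn_integral_has_integral_lebesgue')
qed

lemma poisson_mean:
  assumes "cmod q < 1"
  shows "(\<integral>\<^sup>+t. ennreal (poisson (q * cnj (unit_pt t))) \<partial>turn) = 1"
  using poisson_reproducing[OF assms, of 0] by (simp add: poisson_def)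

text \<open>The limit \<open>L\<close> may be infinite and \<open>f\<close> need not extend to the left end point: both occur for the Green
  function on the diagonal.\<close>

lemma nn_integral_FTC_half_open:
  fixes F f :: "real \<Rightarrow> real"
  assumes ab: "a < b" and [measurable]: "f \<in> borel_measurable borel"
    and der: "\<And>x. a < x \<Longrightarrow> x \<le> b \<Longrightarrow> DERIV F x :> f x"
    and nonneg: "\<And>x. a < x \<Longrightarrow> x \<le> b \<Longrightarrow> 0 \<le> f x"
    and lim: "((\<lambda>x. ennreal (F b - F x)) \<longlongrightarrow> L) (at_right a)"
  shows "(\<integral>\<^sup>+x. ennreal (f x) * indicator {a<..<b} x \<partial>lborel) = L"
proof -
  define s where "s n = a + (b - a) / real (n + 2)" for n :: nat
  have s: "a < s n" "s n \<le> b" for n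
  proof -
    have "(b - a) / real (n + 2) \<le> (b - a) / 1"
      using ab by (intro divide_left_mono) auto
    then show "a < s n" "s n \<le> b" using ab by (auto simp: s_def)
  qed
  have "s \<longlonglongrightarrow> a" unfolding s_def by real_asymp
  then have fl: "filterlim s (at_right a) sequentially"
    using s by (auto simp: filterlim_at less_imp_neq[symmetric])
  have dec: "s (Suc n) \<le> s n" for n
    using ab unfolding s_def by (auto intro!: divide_left_mono mult_pos_pos)
  have "(\<integral>\<^sup>+x. ennreal (f x) * indicator {s n..b} x \<partial>lborel) = ennreal (F b - F (s n))" for n
    using s[of n] by (intro nn_integral_FTC_Icc) (auto intro!: der nonneg intro: has_field_derivative_at_within)
  then have "(\<lambda>n. \<integral>\<^sup>+x. ennreal (f x) * indicator {s n..b} x \<partial>lborel) \<longlonglongrightarrow> L"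
    using filterlim_compose[OF lim fl] by simp
  moreover have "(\<lambda>n. \<integral>\<^sup>+x. ennreal (f x) * indicator {s n..b} x \<partial>lborel)
      \<longlonglongrightarrow> (\<integral>\<^sup>+x. ennreal (f x) * indicator {a<..b} x \<partial>lborel)"
  proof (rule nn_integral_LIMSEQ)
    show "incseq (\<lambda>n x. ennreal (f x) * indicator {s n..b} x)"
      by (auto intro!: incseq_SucI le_funI mult_left_mono order_trans[OF dec] split: split_indicator)
    show "(\<lambda>n. ennreal (f x) * indicator {s n..b} x) \<longlonglongrightarrow> ennreal (f x) * indicator {a<..b} x" for x
    proof (cases "a < x \<and> x \<le> b")
      case True
      then have "\<forall>\<^sub>F n in sequentially. s n < x"
        using \<open>s \<longlonglongrightarrow> a\<close> by (auto dest: order_tendstoD)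
      then have "\<forall>\<^sub>F n in sequentially. ennreal (f x) * indicator {s n..b} x = ennreal (f x) * indicator {a<..b} x"
        by eventually_elim (use True in \<open>auto split: split_indicator\<close>)
      then show ?thesis by (rule tendsto_eventually)
    next
      case False
      then have "ennreal (f x) * indicator {s n..b} x = ennreal (f x) * indicator {a<..b} x" for n
        using s[of n] by (auto split: split_indicator)
      then show ?thesis by simp
    qed
  qed auto
  ultimately have "(\<integral>\<^sup>+x. ennreal (f x) * indicator {a<..b} x \<partial>lborel) = L"
    by (blast intro: LIMSEQ_unique)
  moreover have "(\<integral>\<^sup>+x. ennreal (f x) * indicator {a<..b} x \<partial>lborel) = (\<integral>\<^sup>+x. ennreal (f x) * indicator {a<..<b} x \<partial>lborel)"
    using AE_lborel_singleton[of b] by (intro nn_integral_cong_AE) (auto split: split_indicator)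
  ultimately show ?thesis by simp
qed

section \<open>The Green function as an integral over concentric discs\<close>

lemma green_commute: "green z w = green w z"
proof -
  have "cmod (1 - cnj w * z) = cmod (cnj (1 - cnj z * w))" by (simp add: mult.commute)
  also have "\<dots> = cmod (1 - cnj z * w)" by (rule complex_mod_cnj)
  finally show ?thesis by (auto simp: green_def norm_divide norm_minus_commute)
qed

lemma cmod_mult_cnj_less:
  assumes "max (cmod z) (cmod w) < x"
  shows "cmod (z * cnj w) < x\<^sup>2"
proof -
  have "cmod (z * cnj w) \<le> cmod z * x"
    using assms by (auto simp: norm_mult intro: mult_left_mono)
  also have "\<dots> < x * x" using assms by (intro mult_strict_right_mono) (auto intro: le_less_trans[OF norm_ge_zero])
  finally show ?thesis by (simp add: power2_eq_square)
qed

text \<open>With \<open>c = z \<cdot> cnj w\<close>, the function \<open>F x = ln |x\<^sup>2 - c| - ln x\<close> has derivative \<open>P (c / x\<^sup>2) / x\<close>. At \<open>x = 1\<close> it is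
  \<open>ln |1 - c|\<close>. At \<open>m = max |z| |w|\<close> the modulus \<open>|m\<^sup>2 - c|\<close> factors as \<open>m |z - w|\<close>, so the limit of \<open>F\<close> there is
  \<open>ln |z - w|\<close>, and it is minus infinity when \<open>z = w\<close>.\<close>

lemma green_hadamard:
  assumes z: "cmod z < 1" and w: "cmod w < 1"
  shows "green z w = (\<integral>\<^sup>+x. ennreal (poisson (z * cnj w / of_real (x\<^sup>2)) / x)
           * indicator {max (cmod z) (cmod w)<..<1} x \<partial>lborel)"
proof -
  define c where "c = z * cnj w"
  define m where "m = max (cmod z) (cmod w)"
  define N where "N x = (x\<^sup>2 - Re c)\<^sup>2 + (Im c)\<^sup>2" for x :: real
  define F where "F x = ln (N x) / 2 - ln x" for x :: real
  have m: "0 \<le> m" "m < 1" using z w by (auto simp: m_def le_max_iff_disj)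
  have N: "N x = (cmod (of_real (x\<^sup>2) - c))\<^sup>2" for x by (simp add: N_def cmod_power2)
  have c_less: "cmod c < x\<^sup>2" if "m < x" for x
    unfolding c_def using that m_def by (auto intro!: cmod_mult_cnj_less)
  have N_pos: "0 < N x" if "m < x" for x
    using c_less[OF that] unfolding N by (auto simp: norm_power)
  have c_sq: "(cmod c)\<^sup>2 = (Re c)\<^sup>2 + (Im c)\<^sup>2" by (rule cmod_power2)
  have lim: "((\<lambda>x. ennreal (F 1 - F x)) \<longlongrightarrow> green z w) (at_right m)"
  proof (cases "z = w")
    case True
    then have c: "c = of_real (m\<^sup>2)" by (simp add: c_def m_def complex_norm_square[symmetric])
    have "filterlim (\<lambda>x. F 1 - F x) at_top (at_right m)"
    proof (cases "m = 0")
      case True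
      then show ?thesis unfolding F_def N_def c by simp real_asymp
    next
      case False
      then have "0 < m" using m by simp
      then show ?thesis unfolding F_def N_def c by simp real_asymp
    qed
    then show ?thesis using True by (simp add: green_def ennreal_tendsto_top_eq_at_top)
  next
    case False
    then have m0: "0 < m" using m by (auto simp: m_def max_def split: if_splits)
    have csq: "(complex_of_real (cmod u))\<^sup>2 = u * cnj u" for u
      by (metis complex_norm_square of_real_power)
    have "cmod (of_real (m\<^sup>2) - c) = m * cmod (z - w)"
    proof (cases "cmod z \<le> cmod w")
      case True
      then have "of_real (m\<^sup>2) - c = (w - z) * cnj w"
        unfolding c_def m_def by (simp add: max_def csq algebra_simps)
      then show ?thesis using True by (simp add: norm_mult m_def norm_minus_commute)
    next
      case False
      then have "of_real (m\<^sup>2) - c = z * cnj (z - w)"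
        unfolding c_def m_def by (simp add: max_def csq algebra_simps)
      then show ?thesis using False by (simp add: norm_mult m_def complex_mod_cnj del: complex_cnj_diff)
    qed
    then have Nm: "N m = (m * cmod (z - w))\<^sup>2" by (simp add: N)
    have "N m > 0" using m0 False by (simp add: Nm)
    then have "(F \<longlongrightarrow> F m) (at_right m)"
      unfolding F_def N_def using m0 by (auto intro!: tendsto_eq_intros)
    then have "((\<lambda>x. ennreal (F 1 - F x)) \<longlongrightarrow> ennreal (F 1 - F m)) (at_right m)"
      by (intro tendsto_ennrealI tendsto_diff tendsto_const)
    moreover have "F 1 - F m = ln (cmod ((1 - cnj w * z) / (z - w)))"
    proof -
      have "cmod (1 - c) > 0"
        using cmod_mult_cnj_less[of z w 1] z w by (auto simp: c_def)
      moreover have "F 1 = ln (cmod (1 - c))"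
        using calculation by (simp add: F_def N ln_realpow)
      moreover have "F m = ln (cmod (z - w))"
        unfolding F_def Nm using m0 False by (subst ln_realpow) (auto simp: ln_mult field_simps)
      ultimately show ?thesis
        using False by (simp add: norm_divide ln_div c_def mult.commute)
    qed
    ultimately show ?thesis using False by (simp add: green_def)
  qed
  have "(\<integral>\<^sup>+x. ennreal (poisson (z * cnj w / of_real (x\<^sup>2)) / x)
      * indicator {max (cmod z) (cmod w)<..<1} x \<partial>lborel) = green z w"
  proof (rule nn_integral_FTC_half_open[where F=F])
    show "((\<lambda>x. ennreal (F 1 - F x)) \<longlongrightarrow> green z w) (at_right (max (cmod z) (cmod w)))"
      using lim unfolding m_def .
    show "max (cmod z) (cmod w) < 1" using z w by simp
    show "(\<lambda>x. poisson (z * cnj w / of_real (x\<^sup>2)) / x) \<in> borel_measurable borel" by measurable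
    fix x :: real assume x: "max (cmod z) (cmod w) < x" "x \<le> 1"
    then have x0: "0 < x" and mx: "m < x" using m by (auto simp: m_def)
    have "cmod (1 - c / of_real (x\<^sup>2)) = cmod ((of_real (x\<^sup>2) - c) / of_real (x\<^sup>2))"
      using x0 by (simp add: diff_divide_distrib)
    then have 1: "(cmod (1 - c / of_real (x\<^sup>2)))\<^sup>2 = N x / x ^ 4"
      by (simp add: norm_divide power_divide N norm_power)
    have "poisson (c / of_real (x\<^sup>2)) / x = (1 - (cmod c)\<^sup>2 / x ^ 4) / (N x / x ^ 4) / x"
      unfolding poisson_def 1 by (simp add: norm_divide power_divide norm_power)
    also have "\<dots> = (x ^ 4 - (cmod c)\<^sup>2) / (x * N x)"
      using x0 N_pos[OF mx] by (simp add: field_simps)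
    finally have 2: "poisson (c / of_real (x\<^sup>2)) / x = (x ^ 4 - (cmod c)\<^sup>2) / (x * N x)" .
    have "DERIV N x :> 4 * x * (x\<^sup>2 - Re c)"
      unfolding N_def by (auto intro!: derivative_eq_intros)
    then have "DERIV F x :> 4 * x * (x\<^sup>2 - Re c) / N x / 2 - 1 / x"
      unfolding F_def using x0 N_pos[OF mx] by (auto intro!: derivative_eq_intros)
    also have "4 * x * (x\<^sup>2 - Re c) / N x / 2 - 1 / x = (2 * x\<^sup>2 * (x\<^sup>2 - Re c) - N x) / (x * N x)"
      using x0 N_pos[OF mx] by (simp add: field_simps power2_eq_square)
    also have "2 * x\<^sup>2 * (x\<^sup>2 - Re c) - N x = x ^ 4 - (cmod c)\<^sup>2"
      unfolding N_def c_sq by (simp add: algebra_simps power2_eq_square power4_eq_xxxx)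
    finally show "DERIV F x :> poisson (z * cnj w / of_real (x\<^sup>2)) / x"
      unfolding c_def[symmetric] 2 .
    have "(cmod c)\<^sup>2 \<le> (x\<^sup>2)\<^sup>2" using c_less[OF mx] by (intro power_mono) auto
    then show "0 \<le> poisson (z * cnj w / of_real (x\<^sup>2)) / x"
      unfolding c_def[symmetric] 2 using x0 N_pos[OF mx] by (intro divide_nonneg_pos) auto
  qed
  then show ?thesis ..
qed

section \<open>Circle means and the factorisation of the Green kernel\<close>

lemma measurable_ident_disk: "disk_measure M \<Longrightarrow> (\<lambda>w. w) \<in> borel_measurable M"
  unfolding disk_measure_def
  by (subst measurable_cong_sets[OF _ refl]) (auto intro: measurable_restrict_space1)

lemma measurable_disk: "disk_measure M \<Longrightarrow> f \<in> borel \<rightarrow>\<^sub>M N \<Longrightarrow> f \<in> M \<rightarrow>\<^sub>M N"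
  using measurable_compose[OF measurable_ident_disk] by blast

lemma space_disk: "disk_measure M \<Longrightarrow> space M = unit_disk"
  unfolding disk_measure_def by (drule sets_eq_imp_space_eq) (simp add: space_restrict_space)

interpretation turn: sigma_finite_measure turn by (rule sigma_finite_turn)
interpretation lborel_turn: pair_sigma_finite lborel turn ..

text \<open>The mean is left as an integral because this form also holds, with value infinity, for \<open>z = w = 0\<close>.\<close>

lemma green_circle_mean:
  assumes z: "cmod z < 1" and w: "cmod w < 1"
  shows "(\<integral>\<^sup>+t. green z (w * unit_pt t) \<partial>turn)
       = (\<integral>\<^sup>+x. ennreal (1 / x) * indicator {max (cmod z) (cmod w)<..<1} x \<partial>lborel)"
proof -
  let ?I = "{max (cmod z) (cmod w)<..<1}"
  let ?f = "\<lambda>x t. ennreal (poisson (z * cnj w / of_real (x\<^sup>2) * cnj (unit_pt t)) / x) * indicator ?I x"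
  have "(\<integral>\<^sup>+t. green z (w * unit_pt t) \<partial>turn) = (\<integral>\<^sup>+t. (\<integral>\<^sup>+x. ?f x t \<partial>lborel) \<partial>turn)"
    using z w by (intro nn_integral_cong) (simp add: green_hadamard norm_mult mult_ac)
  also have "\<dots> = (\<integral>\<^sup>+x. (\<integral>\<^sup>+t. ?f x t \<partial>turn) \<partial>lborel)"
    by (rule lborel_turn.Fubini') measurable
  also have "\<dots> = (\<integral>\<^sup>+x. ennreal (1 / x) * indicator ?I x \<partial>lborel)"
  proof (rule nn_integral_cong)
    fix x :: real
    show "(\<integral>\<^sup>+t. ?f x t \<partial>turn) = ennreal (1 / x) * indicator ?I x"
    proof (cases "x \<in> ?I")
      case True
      then have x: "0 < x" "max (cmod z) (cmod w) < x" by (auto intro: le_less_trans[OF norm_ge_zero])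
      then have q: "cmod (z * cnj w / of_real (x\<^sup>2)) < 1"
        using cmod_mult_cnj_less[OF x(2)] by (simp add: norm_divide norm_power)
      have "(\<integral>\<^sup>+t. ?f x t \<partial>turn)
          = (\<integral>\<^sup>+t. ennreal (1 / x) * ennreal (poisson (z * cnj w / of_real (x\<^sup>2) * cnj (unit_pt t))) \<partial>turn)"
        using True x by (intro nn_integral_cong) (simp add: ennreal_mult'[symmetric])
      also have "\<dots> = ennreal (1 / x) * (\<integral>\<^sup>+t. ennreal (poisson (z * cnj w / of_real (x\<^sup>2) * cnj (unit_pt t))) \<partial>turn)"
        by (rule nn_integral_cmult) measurable
      finally show ?thesis using True unfolding poisson_mean[OF q] by simp
    qed simp
  qed
  finally show ?thesis .
qed

lemma nn_integral_inverse:
  assumes "0 < m" "m < 1"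
  shows "(\<integral>\<^sup>+x. ennreal (1 / x) * indicator {m<..<1} x \<partial>lborel) = ennreal (ln (1 / m))"
  by (rule nn_integral_FTC_half_open[where F=ln])
     (use assms in \<open>auto intro!: derivative_eq_intros tendsto_eq_intros simp: ln_div\<close>)

text \<open>The factor \<open>1 / x\<close> of the Hadamard formula is shared equally by the two features, so that
  the underlying measure is plain Lebesgue measure times \<open>turn\<close>.\<close>

definition poisson_feature :: "complex \<Rightarrow> real \<times> real \<Rightarrow> ennreal" where
  "poisson_feature z = (\<lambda>(x, t). if cmod z < x \<and> x < 1
     then ennreal (poisson (z / of_real x * cnj (unit_pt t)) / sqrt x) else 0)"

abbreviation feature_measure :: "(real \<times> real) measure" where
  "feature_measure \<equiv> lborel \<Otimes>\<^sub>M turn"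

lemma poisson_feature_measurable:
  "(\<lambda>(z, y). poisson_feature z y) \<in> borel_measurable (borel \<Otimes>\<^sub>M (borel \<Otimes>\<^sub>M borel))"
  unfolding poisson_feature_def by measurable

lemma measurable_feature_pair:
  assumes "disk_measure M"
  shows "(\<lambda>(w, y). poisson_feature w y) \<in> borel_measurable (M \<Otimes>\<^sub>M feature_measure)"
proof -
  have "sets feature_measure = sets (borel \<Otimes>\<^sub>M borel)"
    by (intro sets_pair_measure_cong) auto
  then have "snd \<in> (M \<Otimes>\<^sub>M feature_measure) \<rightarrow>\<^sub>M (borel \<Otimes>\<^sub>M borel)"
    using measurable_snd measurable_cong_sets by blast
  then have "(\<lambda>p. (fst p, snd p)) \<in> (M \<Otimes>\<^sub>M feature_measure) \<rightarrow>\<^sub>M (borel \<Otimes>\<^sub>M (borel \<Otimes>\<^sub>M borel))"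
    by (intro measurable_Pair measurable_compose[OF measurable_fst measurable_ident_disk[OF assms]])
  from measurable_compose[OF this poisson_feature_measurable] show ?thesis
    by (simp add: split_beta')
qed

lemma green_eq_feature_product:
  assumes z: "cmod z < 1" and w: "cmod w < 1"
  shows "green z w = (\<integral>\<^sup>+y. poisson_feature z y * poisson_feature w y \<partial>feature_measure)"
proof -
  have [measurable]: "poisson_feature u \<in> borel_measurable feature_measure" for u
    unfolding poisson_feature_def by measurable
  let ?q = "\<lambda>x. z * cnj w / of_real (x\<^sup>2)"
  have "(\<integral>\<^sup>+y. poisson_feature z y * poisson_feature w y \<partial>feature_measure)
      = (\<integral>\<^sup>+x. (\<integral>\<^sup>+t. poisson_feature z (x, t) * poisson_feature w (x, t) \<partial>turn) \<partial>lborel)"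
    by (rule turn.nn_integral_fst[symmetric]) measurable
  also have "\<dots> = (\<integral>\<^sup>+x. ennreal (poisson (?q x) / x) * indicator {max (cmod z) (cmod w)<..<1} x \<partial>lborel)"
  proof (rule nn_integral_cong)
    fix x :: real
    show "(\<integral>\<^sup>+t. poisson_feature z (x, t) * poisson_feature w (x, t) \<partial>turn)
        = ennreal (poisson (?q x) / x) * indicator {max (cmod z) (cmod w)<..<1} x"
    proof (cases "x \<in> {max (cmod z) (cmod w)<..<1}")
      case True
      then have x: "0 < x" "cmod z < x" "cmod w < x" "x < 1" by (auto intro: le_less_trans[OF norm_ge_zero])
      let ?P = "\<lambda>t. poisson (z / of_real x * cnj (unit_pt t)) * poisson (w / of_real x * cnj (unit_pt t))"
      have "(\<integral>\<^sup>+t. poisson_feature z (x, t) * poisson_feature w (x, t) \<partial>turn)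
          = (\<integral>\<^sup>+t. ennreal (1 / x) * ennreal (?P t) \<partial>turn)"
      proof (rule nn_integral_cong)
        fix t
        have "0 \<le> poisson (u / of_real x * cnj (unit_pt t))" if "cmod u < x" for u
          using x that by (intro poisson_nonneg) (simp add: norm_mult norm_divide)
        then show "poisson_feature z (x, t) * poisson_feature w (x, t) = ennreal (1 / x) * ennreal (?P t)"
          using x by (simp add: poisson_feature_def ennreal_mult'[symmetric] field_simps)
      qed
      also have "\<dots> = ennreal (1 / x) * (\<integral>\<^sup>+t. ennreal (?P t) \<partial>turn)"
        by (rule nn_integral_cmult) measurable
      also have "\<dots> = ennreal (1 / x) * ennreal (poisson (z / of_real x * cnj (w / of_real x)))"
        using x by (subst poisson_reproducing) (auto simp: norm_divide)
      finally show ?thesis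
        using True x by (simp add: ennreal_mult'[symmetric] power2_eq_square)
    qed (auto simp: poisson_feature_def)
  qed
  also have "\<dots> = green z w" using green_hadamard[OF z w] by simp
  finally show ?thesis ..
qed

definition mean_feature :: "complex measure \<Rightarrow> real \<times> real \<Rightarrow> ennreal" where
  "mean_feature M y = (\<integral>\<^sup>+w. poisson_feature w y \<partial>M)"

lemma mean_feature_measurable:
  assumes "disk_measure M" "sigma_finite_measure M"
  shows "mean_feature M \<in> borel_measurable feature_measure"
proof -
  interpret sigma_finite_measure M by fact
  have "(\<lambda>p. (snd p, fst p)) \<in> (feature_measure \<Otimes>\<^sub>M M) \<rightarrow>\<^sub>M (M \<Otimes>\<^sub>M feature_measure)" by measurable
  from measurable_compose[OF this measurable_feature_pair[OF assms(1)]]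
  have "(\<lambda>(y, w). poisson_feature w y) \<in> borel_measurable (feature_measure \<Otimes>\<^sub>M M)"
    by (simp add: split_beta')
  from borel_measurable_nn_integral[OF this] show ?thesis
    unfolding mean_feature_def .
qed

lemma green_potential_eq_feature:
  assumes M: "disk_measure M" "sigma_finite_measure M" and z: "cmod z < 1"
  shows "green_potential M z = (\<integral>\<^sup>+y. poisson_feature z y * mean_feature M y \<partial>feature_measure)"
proof -
  interpret M: sigma_finite_measure M by fact
  interpret P: pair_sigma_finite M feature_measure ..
  have [measurable]: "poisson_feature u \<in> borel_measurable feature_measure" for u
    unfolding poisson_feature_def by measurable
  note [measurable] = measurable_feature_pair[OF M(1)]
  have "green_potential M z
      = (\<integral>\<^sup>+w. (\<integral>\<^sup>+y. poisson_feature z y * poisson_feature w y \<partial>feature_measure) \<partial>M)"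
    unfolding green_potential_def
    by (intro nn_integral_cong) (use z in \<open>simp add: green_eq_feature_product space_disk[OF M(1)]\<close>)
  also have "\<dots> = (\<integral>\<^sup>+y. (\<integral>\<^sup>+w. poisson_feature z y * poisson_feature w y \<partial>M) \<partial>feature_measure)"
    by (rule P.Fubini'[symmetric]) measurable
  also have "\<dots> = (\<integral>\<^sup>+y. poisson_feature z y * mean_feature M y \<partial>feature_measure)"
    unfolding mean_feature_def by (intro nn_integral_cong nn_integral_cmult) measurable
  finally show ?thesis .
qed

lemma mutual_energy_eq_feature:
  assumes M: "disk_measure M" "sigma_finite_measure M" and N: "disk_measure N" "sigma_finite_measure N"
  shows "(\<integral>\<^sup>+z. green_potential N z \<partial>M) = (\<integral>\<^sup>+y. mean_feature M y * mean_feature N y \<partial>feature_measure)"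
proof -
  interpret M: sigma_finite_measure M by fact
  interpret P: pair_sigma_finite M feature_measure ..
  note [measurable] = measurable_feature_pair[OF M(1)] mean_feature_measurable[OF N]
  have "(\<integral>\<^sup>+z. green_potential N z \<partial>M)
      = (\<integral>\<^sup>+z. (\<integral>\<^sup>+y. poisson_feature z y * mean_feature N y \<partial>feature_measure) \<partial>M)"
    by (intro nn_integral_cong) (simp add: green_potential_eq_feature[OF N] space_disk[OF M(1)])
  also have "\<dots> = (\<integral>\<^sup>+y. (\<integral>\<^sup>+z. poisson_feature z y * mean_feature N y \<partial>M) \<partial>feature_measure)"
    by (rule P.Fubini'[symmetric]) measurable
  also have "\<dots> = (\<integral>\<^sup>+y. mean_feature M y * mean_feature N y \<partial>feature_measure)"
    unfolding mean_feature_def[of M] by (intro nn_integral_cong nn_integral_multc) measurable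
  finally show ?thesis .
qed

lemma green_energy_eq: "green_energy M = (\<integral>\<^sup>+z. green_potential M z \<partial>M)"
  unfolding green_energy_def green_potential_def
  by (intro nn_integral_cong) (simp add: green_commute)

section \<open>Hyperbolic circle means of Green potentials\<close>

lemma measurable_pair_disk:
  assumes "disk_measure M" "sets A = sets B" "case_prod g \<in> borel_measurable (B \<Otimes>\<^sub>M borel)"
  shows "case_prod g \<in> borel_measurable (A \<Otimes>\<^sub>M M)"
proof -
  have "fst \<in> (A \<Otimes>\<^sub>M M) \<rightarrow>\<^sub>M B"
    using measurable_fst measurable_cong_sets[OF refl assms(2)] by blast
  then have "(\<lambda>p. (fst p, snd p)) \<in> (A \<Otimes>\<^sub>M M) \<rightarrow>\<^sub>M (B \<Otimes>\<^sub>M borel)"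
    by (intro measurable_Pair measurable_compose[OF measurable_snd measurable_ident_disk[OF assms(1)]])
  from measurable_compose[OF this assms(3)] show ?thesis by simp
qed

lemma green_measurable: "(\<lambda>(z, w). green z w) \<in> borel_measurable (borel \<Otimes>\<^sub>M borel)"
  unfolding green_def by measurable

lemma measurable_green_right: "green z \<in> borel_measurable borel"
proof -
  have "(\<lambda>w. (z, w)) \<in> borel \<rightarrow>\<^sub>M (borel \<Otimes>\<^sub>M borel)" by measurable
  from measurable_compose[OF this green_measurable] show ?thesis by simp
qed

definition disk_auto :: "complex \<Rightarrow> complex \<Rightarrow> complex" where
  "disk_auto a z = (a - z) / (1 - cnj a * z)"

lemma disk_auto_norm_less_1:
  assumes "cmod a < 1" "cmod z < 1"
  shows "cmod (disk_auto a z) < 1"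
  using Moebius_function_norm_lt_1[OF assms, of 0]
  by (simp add: disk_auto_def Moebius_function_def norm_divide norm_minus_commute)

text \<open>Moebius invariance of the Green function, for the automorphism that exchanges \<open>0\<close> and \<open>a\<close>. This
  automorphism is an involution, so it may be moved from one argument to the other.\<close>

lemma green_disk_auto:
  assumes a: "cmod a < 1" and z: "cmod z < 1" and w: "cmod w < 1"
  shows "green (disk_auto a z) w = green z (disk_auto a w)"
proof -
  define p q where "p = 1 - cnj a * z" and "q = 1 - cnj a * w"
  define X Y where "X = (a - w) - z * (1 - cnj a * w)" and "Y = (1 - cnj w * a) - z * (cnj a - cnj w)"
  have p: "p \<noteq> 0" and q: "q \<noteq> 0"
    unfolding p_def q_def using one_minus_cnj_mult_neq_0[OF a] z w by (auto intro: less_imp_le)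
  have 1: "disk_auto a z - w = X / p"
    using p unfolding disk_auto_def p_def[symmetric] by (simp add: divide_simps) (simp add: X_def p_def algebra_simps)
  have 2: "1 - cnj w * disk_auto a z = Y / p"
    using p unfolding disk_auto_def p_def[symmetric] by (simp add: divide_simps) (simp add: Y_def p_def algebra_simps)
  have 3: "z - disk_auto a w = - X / q"
    using q unfolding disk_auto_def q_def[symmetric] by (simp add: divide_simps) (simp add: X_def q_def algebra_simps)
  have cnj_w: "cnj (disk_auto a w) = (cnj a - cnj w) / cnj q"
    by (simp add: disk_auto_def q_def)
  have "1 - cnj (disk_auto a w) * z = (cnj q - (cnj a - cnj w) * z) / cnj q"
    unfolding cnj_w using q by (simp add: diff_divide_distrib left_diff_distrib)
  also have "cnj q - (cnj a - cnj w) * z = Y"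
    by (simp add: Y_def q_def algebra_simps)
  finally have 4: "1 - cnj (disk_auto a w) * z = Y / cnj q" .
  have "disk_auto a z = w \<longleftrightarrow> X = 0" using 1 p by (metis divide_eq_0_iff eq_iff_diff_eq_0)
  moreover have "z = disk_auto a w \<longleftrightarrow> X = 0" using 3 q by (metis divide_eq_0_iff eq_iff_diff_eq_0 neg_equal_0_iff_equal)
  ultimately show ?thesis
    unfolding green_def 1 2 3 4 using p q by (simp add: norm_divide norm_mult)
qed

lemma green_potential_hyperbolic_circle_mean:
  assumes M: "disk_measure M" "sigma_finite_measure M" and a: "cmod a < 1" and \<rho>: "0 < \<rho>" "\<rho> < 1"
  shows "(\<integral>\<^sup>+t. green_potential M (disk_auto a (\<rho> * unit_pt t)) \<partial>turn)
       = (\<integral>\<^sup>+w. ennreal (ln (1 / max \<rho> (cmod (disk_auto a w)))) \<partial>M)"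
proof -
  interpret M: sigma_finite_measure M by fact
  interpret P: pair_sigma_finite turn M ..
  have "(\<lambda>p. (disk_auto a (\<rho> * unit_pt (fst p)), snd p)) \<in> (borel \<Otimes>\<^sub>M borel) \<rightarrow>\<^sub>M (borel \<Otimes>\<^sub>M borel)"
    unfolding disk_auto_def by measurable
  from measurable_compose[OF this green_measurable]
  have "(\<lambda>(t, w). green (disk_auto a (\<rho> * unit_pt t)) w) \<in> borel_measurable (borel \<Otimes>\<^sub>M borel)"
    by (simp add: split_beta')
  then have "(\<lambda>(t, w). green (disk_auto a (\<rho> * unit_pt t)) w) \<in> borel_measurable (turn \<Otimes>\<^sub>M M)"
    by (intro measurable_pair_disk[OF M(1), where B=borel]) auto
  then have "(\<integral>\<^sup>+t. green_potential M (disk_auto a (\<rho> * unit_pt t)) \<partial>turn)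
      = (\<integral>\<^sup>+w. (\<integral>\<^sup>+t. green (disk_auto a (\<rho> * unit_pt t)) w \<partial>turn) \<partial>M)"
    unfolding green_potential_def by (rule P.Fubini'[symmetric])
  also have "\<dots> = (\<integral>\<^sup>+w. ennreal (ln (1 / max \<rho> (cmod (disk_auto a w)))) \<partial>M)"
  proof (rule nn_integral_cong)
    fix w assume "w \<in> space M"
    then have w: "cmod w < 1" by (simp add: space_disk[OF M(1)])
    have aw: "cmod (disk_auto a w) < 1" by (rule disk_auto_norm_less_1[OF a w])
    have "(\<integral>\<^sup>+t. green (disk_auto a (\<rho> * unit_pt t)) w \<partial>turn)
        = (\<integral>\<^sup>+t. green (disk_auto a w) (of_real \<rho> * unit_pt t) \<partial>turn)"
      using \<rho> by (intro nn_integral_cong, subst green_disk_auto[OF a _ w])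
        (auto simp: norm_mult intro: green_commute)
    also have "\<dots> = (\<integral>\<^sup>+x. ennreal (1 / x) * indicator {max (cmod (disk_auto a w)) \<rho><..<1} x \<partial>lborel)"
      using \<rho> by (subst green_circle_mean[OF aw]) auto
    also have "\<dots> = ennreal (ln (1 / max (cmod (disk_auto a w)) \<rho>))"
      using \<rho> aw by (intro nn_integral_inverse) (auto simp: less_max_iff_disj)
    finally show "(\<integral>\<^sup>+t. green (disk_auto a (\<rho> * unit_pt t)) w \<partial>turn)
        = ennreal (ln (1 / max \<rho> (cmod (disk_auto a w))))"
      by (simp add: max.commute)
  qed
  finally show ?thesis .
qed

text \<open>The logarithmic potential of a circle of radius 1 minus that of a circle of radius 2, as a function of
  the distance from their common centre: a continuous bump supported in \<open>[0, 2]\<close>.\<close>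

definition collar :: "real \<Rightarrow> real" where
  "collar t = ln (max 2 t / max 1 t)"

lemma collar_measurable [measurable]: "collar \<in> borel_measurable borel"
  unfolding collar_def by measurable

lemma collar_nonneg: "0 \<le> collar t"
  by (auto simp: collar_def max_def)

lemma collar_le: "collar t \<le> ln 2"
proof -
  have "max 2 t / max 1 t \<le> 2" by (auto simp: max_def field_simps)
  then show ?thesis unfolding collar_def by (intro ln_mono) (auto intro!: divide_pos_pos simp: less_max_iff_disj)
qed

lemma collar_eq_0: "2 \<le> t \<Longrightarrow> collar t = 0"
  by (simp add: collar_def max_def)

lemma isCont_collar: "isCont collar t"
  unfolding collar_def by (intro continuous_intros) (auto simp: max_def split: if_splits)

lemma ln_inverse_max_split:
  assumes "0 < \<rho>" "0 \<le> d"
  shows "ln (1 / max \<rho> d) = ln (1 / max (2 * \<rho>) d) + collar (d / \<rho>)"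
proof -
  have "max (2 * \<rho>) d = \<rho> * max 2 (d / \<rho>)" "max \<rho> d = \<rho> * max 1 (d / \<rho>)"
    using assms by (auto simp: max_def field_simps)
  moreover have "0 < max 2 (d / \<rho>)" "0 < max 1 (d / \<rho>)" by auto
  ultimately show ?thesis
    using assms unfolding collar_def by (simp add: ln_div ln_mult)
qed

text \<open>The integral of the bump is the difference of two circle means of the potential. Boundedness
  of the potential makes the subtrahend finite, so that it can be cancelled.\<close>

lemma collar_integral_determined_by_potential:
  assumes M: "disk_measure M" "sigma_finite_measure M" and N: "disk_measure N" "sigma_finite_measure N"
    and eq: "\<And>z. cmod z < 1 \<Longrightarrow> green_potential M z = green_potential N z"
    and bounded: "\<And>z. cmod z < 1 \<Longrightarrow> green_potential M z \<le> ennreal C"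
    and a: "cmod a < 1" and \<rho>: "0 < \<rho>" "\<rho> < 1 / 2"
  shows "(\<integral>\<^sup>+w. ennreal (collar (cmod (disk_auto a w) / \<rho>)) \<partial>M)
       = (\<integral>\<^sup>+w. ennreal (collar (cmod (disk_auto a w) / \<rho>)) \<partial>N)"
proof -
  define A where "A \<rho> = (\<integral>\<^sup>+t. green_potential M (disk_auto a (of_real \<rho> * unit_pt t)) \<partial>turn)" for \<rho>
  have disk: "cmod (disk_auto a (of_real \<rho>' * unit_pt t)) < 1" if "0 < \<rho>'" "\<rho>' < 1" for \<rho>' t
    using that by (intro disk_auto_norm_less_1[OF a]) (auto simp: norm_mult)
  have AM: "A \<rho>' = (\<integral>\<^sup>+w. ennreal (ln (1 / max \<rho>' (cmod (disk_auto a w)))) \<partial>M)" if "0 < \<rho>'" "\<rho>' < 1" for \<rho>'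
    unfolding A_def using that by (intro green_potential_hyperbolic_circle_mean M a)
  have AN: "A \<rho>' = (\<integral>\<^sup>+w. ennreal (ln (1 / max \<rho>' (cmod (disk_auto a w)))) \<partial>N)" if "0 < \<rho>'" "\<rho>' < 1" for \<rho>'
    unfolding A_def using that green_potential_hyperbolic_circle_mean[OF N a that]
    by (simp add: eq disk)
  have "A (2 * \<rho>) \<le> (\<integral>\<^sup>+t. ennreal C \<partial>turn)"
    unfolding A_def using \<rho> disk[of "2 * \<rho>"] by (intro nn_integral_mono bounded) simp
  then have fin: "A (2 * \<rho>) \<noteq> \<infinity>" by (auto simp: top_unique)
  have split: "(\<integral>\<^sup>+w. ennreal (ln (1 / max \<rho> (cmod (disk_auto a w)))) \<partial>L)
      = (\<integral>\<^sup>+w. ennreal (ln (1 / max (2 * \<rho>) (cmod (disk_auto a w)))) \<partial>L)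
        + (\<integral>\<^sup>+w. ennreal (collar (cmod (disk_auto a w) / \<rho>)) \<partial>L)" if L: "disk_measure L" for L
  proof -
    have [measurable]: "(\<lambda>w. ennreal (ln (1 / max (2 * \<rho>) (cmod (disk_auto a w))))) \<in> borel_measurable L"
      by (rule measurable_disk[OF L], unfold disk_auto_def) measurable
    have [measurable]: "(\<lambda>w. ennreal (collar (cmod (disk_auto a w) / \<rho>))) \<in> borel_measurable L"
      by (rule measurable_disk[OF L], unfold disk_auto_def) measurable
    have "ennreal (ln (1 / max \<rho> (cmod (disk_auto a w))))
        = ennreal (ln (1 / max (2 * \<rho>) (cmod (disk_auto a w)))) + ennreal (collar (cmod (disk_auto a w) / \<rho>))"
      if "w \<in> space L" for w
    proof -
      have "cmod (disk_auto a w) < 1"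
        using that by (intro disk_auto_norm_less_1[OF a]) (simp add: space_disk[OF L])
      then have "0 < max (2 * \<rho>) (cmod (disk_auto a w))" "max (2 * \<rho>) (cmod (disk_auto a w)) \<le> 1"
        using \<rho> by (auto simp: less_max_iff_disj)
      then have "0 \<le> ln (1 / max (2 * \<rho>) (cmod (disk_auto a w)))"
        by (intro ln_ge_zero) (simp only: le_divide_eq_1_pos)
      then show ?thesis
        unfolding ln_inverse_max_split[OF \<rho>(1) norm_ge_zero] using collar_nonneg by (rule ennreal_plus)
    qed
    then have "(\<integral>\<^sup>+w. ennreal (ln (1 / max \<rho> (cmod (disk_auto a w)))) \<partial>L)
      = (\<integral>\<^sup>+w. ennreal (ln (1 / max (2 * \<rho>) (cmod (disk_auto a w)))) + ennreal (collar (cmod (disk_auto a w) / \<rho>)) \<partial>L)"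
      by (rule nn_integral_cong)
    then show ?thesis by (simp add: nn_integral_add)
  qed
  have bnds: "0 < \<rho>" "\<rho> < 1" "0 < 2 * \<rho>" "2 * \<rho> < 1" using \<rho> by auto
  have "A (2 * \<rho>) + (\<integral>\<^sup>+w. ennreal (collar (cmod (disk_auto a w) / \<rho>)) \<partial>M) = A \<rho>"
    using split[OF M(1)] unfolding AM[OF bnds(1,2), symmetric] AM[OF bnds(3,4), symmetric] by simp
  also have "\<dots> = A (2 * \<rho>) + (\<integral>\<^sup>+w. ennreal (collar (cmod (disk_auto a w) / \<rho>)) \<partial>N)"
    using split[OF N(1)] unfolding AN[OF bnds(1,2), symmetric] AN[OF bnds(3,4), symmetric] by simp
  finally have "A (2 * \<rho>) + (\<integral>\<^sup>+w. ennreal (collar (cmod (disk_auto a w) / \<rho>)) \<partial>M)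
      = A (2 * \<rho>) + (\<integral>\<^sup>+w. ennreal (collar (cmod (disk_auto a w) / \<rho>)) \<partial>N)" .
  then show ?thesis using fin by (simp add: ennreal_add_left_cancel)
qed

section \<open>An approximate identity of hyperbolic collars\<close>

lemma nn_integral_complex_affine:
  fixes f :: "complex \<Rightarrow> ennreal"
  assumes [measurable]: "f \<in> borel_measurable borel" and c: "0 < c"
  shows "(\<integral>\<^sup>+v. f v \<partial>lborel) = ennreal (c\<^sup>2) * (\<integral>\<^sup>+v. f (t + of_real c * v) \<partial>lborel)"
proof -
  have "(\<integral>\<^sup>+v. f v \<partial>lborel) = (\<integral>\<^sup>+v. f v \<partial>density (distr lborel borel (\<lambda>x. t + c *\<^sub>R x)) (\<lambda>_. ennreal (\<bar>c\<bar> ^ DIM(complex))))"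
    using lborel_affine[of c t] c by simp
  also have "\<dots> = (\<integral>\<^sup>+v. ennreal (c\<^sup>2) * f (t + c *\<^sub>R v) \<partial>lborel)"
    by (subst nn_integral_density) (simp_all add: nn_integral_distr)
  also have "\<dots> = ennreal (c\<^sup>2) * (\<integral>\<^sup>+v. f (t + c *\<^sub>R v) \<partial>lborel)"
    by (rule nn_integral_cmult) measurable
  finally show ?thesis by (simp add: scaleR_conv_of_real)
qed

definition collar_mass :: ennreal where
  "collar_mass = (\<integral>\<^sup>+v. ennreal (collar (cmod v)) \<partial>lborel)"

lemma collar_mass_finite: "collar_mass < \<infinity>"
proof -
  have "collar_mass \<le> (\<integral>\<^sup>+v. ennreal (ln 2) * indicator (cball 0 2) (v :: complex) \<partial>lborel)"
    unfolding collar_mass_def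
    by (intro nn_integral_mono) (auto split: split_indicator intro!: ennreal_leI simp: collar_le collar_eq_0)
  also have "\<dots> < \<infinity>"
    by (simp add: nn_integral_cmult_indicator emeasure_cball ennreal_mult_less_top)
  finally show ?thesis .
qed

lemma collar_mass_pos: "collar_mass \<noteq> 0"
proof
  assume "collar_mass = 0"
  have "(\<integral>\<^sup>+v. ennreal (ln 2) * indicator (cball 0 1) (v :: complex) \<partial>lborel) \<le> collar_mass"
    unfolding collar_mass_def
    by (intro nn_integral_mono) (auto split: split_indicator simp: collar_def)
  with \<open>collar_mass = 0\<close> show False
    by (simp add: nn_integral_cmult_indicator emeasure_cball ennreal_mult'[symmetric] unit_ball_vol_2)
qed

lemma collar_mass_scale:
  assumes "0 < c"
  shows "(\<integral>\<^sup>+v. ennreal (collar (cmod v / c)) \<partial>lborel) = ennreal (c\<^sup>2) * collar_mass"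
  unfolding collar_mass_def using assms
  by (subst nn_integral_complex_affine[OF _ assms, where t=0]) (auto simp: norm_mult)

text \<open>The inner integral is what remains of \<open>\<integral> f a \<cdot> collar (\<delta> a w / \<rho>) da / \<rho>\<^sup>2\<close> after the substitution \<open>a = w + \<rho> v\<close>, where
  \<open>\<delta> a w = |a - w| / |1 - cnj a \<cdot> w|\<close>. As \<open>\<rho>\<close> tends to 0 the denominator tends to \<open>1 - |w|\<^sup>2\<close>; rescaling \<open>v\<close> by
  this number produces the factor \<open>(1 - |w|\<^sup>2)\<^sup>2\<close>, the reciprocal of the hyperbolic area density up to a constant.
  The radii \<open>\<rho> n\<close> are small enough that the integrands vanish unless \<open>|w| < (1 + s) / 2\<close>, a disc of finite
  measure, and \<open>|v| \<le> 4\<close>.\<close>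

lemma collar_approximate_identity:
  assumes M: "disk_measure M" and fin: "\<And>s. s < 1 \<Longrightarrow> emeasure M (ball 0 s) < \<infinity>"
    and f [measurable]: "f \<in> borel_measurable borel" and f_bound: "\<And>z. 0 \<le> f z \<and> f z \<le> B"
    and s: "0 < s" "s < 1" and f_supp: "\<And>z. s \<le> cmod z \<Longrightarrow> f z = 0"
    and f_cont: "\<And>z. cmod z < 1 \<Longrightarrow> isCont f z"
  defines "\<rho> n \<equiv> (1 - s) / real (n + 1) / 8"
  shows "(\<lambda>n. \<integral>\<^sup>+w. (\<integral>\<^sup>+v. ennreal (f (w + \<rho> n * v) * collar (cmod v / cmod (1 - cnj (w + \<rho> n * v) * w))) \<partial>lborel) \<partial>M)
    \<longlonglongrightarrow> (\<integral>\<^sup>+w. ennreal (f w * (1 - (cmod w)\<^sup>2)\<^sup>2) \<partial>M) * collar_mass"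
proof -
  define F where "F n w v = ennreal (f (w + \<rho> n * v) * collar (cmod v / cmod (1 - cnj (w + \<rho> n * v) * w)))"
    for n w and v :: complex
  have \<rho>_pos: "0 < \<rho> n" for n
    using s by (simp add: \<rho>_def)
  have \<rho>_le: "8 * \<rho> n \<le> 1 - s" for n
  proof -
    define q where "q = (1 - s) / real (n + 1)"
    have "q \<le> (1 - s) / 1"
      unfolding q_def using s by (intro divide_left_mono) auto
    moreover have "\<rho> n = q / 8" by (simp only: \<rho>_def q_def)
    ultimately show ?thesis using s by simp
  qed
  have \<rho>_lim: "\<rho> \<longlonglongrightarrow> 0" unfolding \<rho>_def by real_asymp
  have [measurable]: "(\<lambda>(w, v). F n w v) \<in> borel_measurable (borel \<Otimes>\<^sub>M borel)" for n
    unfolding F_def by measurable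
  have [measurable]: "cball (0 :: complex) 4 \<in> sets borel" "ball (0 :: complex) ((1 + s) / 2) \<in> sets borel"
    by auto
  have B: "0 \<le> B" using f_bound[of 0] by linarith
  have F_le: "F n w v \<le> ennreal (B * ln 2) * indicator (cball 0 4) v * indicator (ball 0 ((1 + s) / 2)) w"
    if w: "cmod w < 1" for n w v
  proof (cases "F n w v = 0")
    case False
    define a where "a = w + \<rho> n * v"
    have "f a \<noteq> 0" and col: "collar (cmod v / cmod (1 - cnj a * w)) \<noteq> 0"
      using False by (auto simp: F_def a_def)
    then have as: "cmod a < s" using f_supp[of a] by (meson not_le)
    have "1 - cnj a * w \<noteq> 0" using as s w by (intro one_minus_cnj_mult_neq_0) auto
    then have pos: "0 < cmod (1 - cnj a * w)" by simp
    have "cmod (cnj a * w) \<le> 1 * 1"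
      unfolding norm_mult complex_mod_cnj using as s w by (intro mult_mono) auto
    then have "cmod (1 - cnj a * w) \<le> 2"
      using norm_triangle_ineq4[of 1 "cnj a * w"] by simp
    moreover have "cmod v / cmod (1 - cnj a * w) < 2" using col collar_eq_0 by (meson not_le)
    ultimately have v: "cmod v \<le> 4" using pos by (simp add: field_simps)
    have "cmod w \<le> cmod a + cmod (\<rho> n * v)"
      using norm_triangle_ineq4[of a "\<rho> n * v"] by (simp add: a_def)
    also have "cmod (\<rho> n * v) \<le> \<rho> n * 4"
      unfolding norm_mult using \<rho>_pos[of n] v by (simp add: mult_left_mono)
    finally have "cmod w < (1 + s) / 2" using as \<rho>_le[of n] by (simp add: field_simps)
    moreover have "f a * collar (cmod v / cmod (1 - cnj a * w)) \<le> B * ln 2"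
      using f_bound collar_le collar_nonneg B by (intro mult_mono) auto
    ultimately show ?thesis using v by (simp add: F_def a_def[symmetric] ennreal_leI)
  qed simp
  have F_lim: "(\<lambda>n. F n w v) \<longlonglongrightarrow> ennreal (f w * collar (cmod v / (1 - (cmod w)\<^sup>2)))"
    if w: "cmod w < 1" for w v
  proof -
    have a: "(\<lambda>n. w + \<rho> n * v) \<longlonglongrightarrow> w"
      using tendsto_add[OF tendsto_const tendsto_mult[OF tendsto_of_real[OF \<rho>_lim] tendsto_const]] by simp
    then have "(\<lambda>n. cmod (1 - cnj (w + \<rho> n * v) * w)) \<longlonglongrightarrow> cmod (1 - cnj w * w)"
      by (intro tendsto_intros)
    moreover have "1 - cnj w * w = of_real (1 - (cmod w)\<^sup>2)"
      by (metis complex_norm_square mult.commute of_real_1 of_real_diff)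
    moreover have "0 < 1 - (cmod w)\<^sup>2" using w by (simp add: abs_square_less_1)
    ultimately have "(\<lambda>n. cmod (1 - cnj (w + \<rho> n * v) * w)) \<longlonglongrightarrow> 1 - (cmod w)\<^sup>2"
      by (metis abs_of_pos norm_of_real)
    then have "(\<lambda>n. cmod v / cmod (1 - cnj (w + \<rho> n * v) * w)) \<longlonglongrightarrow> cmod v / (1 - (cmod w)\<^sup>2)"
      using \<open>0 < 1 - (cmod w)\<^sup>2\<close> by (intro tendsto_intros) auto
    then show ?thesis
      unfolding F_def
      by (intro tendsto_ennrealI tendsto_mult isCont_tendsto_compose[OF isCont_collar]
          isCont_tendsto_compose[OF f_cont[OF w]] a)
  qed
  have inner: "(\<lambda>n. \<integral>\<^sup>+v. F n w v \<partial>lborel) \<longlonglongrightarrow> ennreal (f w * (1 - (cmod w)\<^sup>2)\<^sup>2) * collar_mass"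
    if w: "cmod w < 1" for w
  proof -
    have "(\<lambda>n. \<integral>\<^sup>+v. F n w v \<partial>lborel) \<longlonglongrightarrow> (\<integral>\<^sup>+v. ennreal (f w * collar (cmod v / (1 - (cmod w)\<^sup>2))) \<partial>lborel)"
    proof (rule nn_integral_dominated_convergence[where w="\<lambda>v :: complex. ennreal (B * ln 2) * indicator (cball 0 4) v"])
      show "(\<lambda>v :: complex. ennreal (B * ln 2) * indicator (cball 0 4) v) \<in> borel_measurable lborel"
        by measurable
      show "AE v in lborel. F n w v \<le> ennreal (B * ln 2) * indicator (cball 0 4) v" for n
        using F_le[OF w] by (intro AE_I2 order_trans[OF F_le[OF w]]) (auto split: split_indicator)
      show "(\<integral>\<^sup>+v. ennreal (B * ln 2) * indicator (cball 0 4) v \<partial>(lborel :: complex measure)) < \<infinity>"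
        by (simp add: nn_integral_cmult_indicator emeasure_cball ennreal_mult_less_top)
    qed (use F_lim[OF w] in auto)
    also have "(\<integral>\<^sup>+v. ennreal (f w * collar (cmod v / (1 - (cmod w)\<^sup>2))) \<partial>lborel)
        = ennreal (f w) * (\<integral>\<^sup>+v. ennreal (collar (cmod v / (1 - (cmod w)\<^sup>2))) \<partial>lborel)"
      using f_bound by (subst nn_integral_cmult[symmetric]) (auto simp: ennreal_mult' collar_nonneg)
    also have "\<dots> = ennreal (f w * (1 - (cmod w)\<^sup>2)\<^sup>2) * collar_mass"
      using w f_bound by (subst collar_mass_scale) (auto simp: abs_square_less_1 ennreal_mult mult_ac)
    finally show ?thesis .
  qed
  have "(\<lambda>n. \<integral>\<^sup>+w. (\<integral>\<^sup>+v. F n w v \<partial>lborel) \<partial>M) \<longlonglongrightarrow> (\<integral>\<^sup>+w. ennreal (f w * (1 - (cmod w)\<^sup>2)\<^sup>2) * collar_mass \<partial>M)"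
  proof (rule nn_integral_dominated_convergence)
    let ?W = "\<lambda>w. ennreal (B * ln 2) * emeasure lborel (cball (0 :: complex) 4) * indicator (ball (0 :: complex) ((1 + s) / 2)) w"
    show "(\<lambda>w. \<integral>\<^sup>+v. F n w v \<partial>lborel) \<in> borel_measurable M" for n
      by (rule measurable_disk[OF M]) measurable
    show "(\<lambda>w. ennreal (f w * (1 - (cmod w)\<^sup>2)\<^sup>2) * collar_mass) \<in> borel_measurable M" "?W \<in> borel_measurable M"
      by (rule measurable_disk[OF M]; measurable)+
    show "AE w in M. (\<integral>\<^sup>+v. F n w v \<partial>lborel) \<le> ?W w" for n
    proof (rule AE_I2)
      fix w assume "w \<in> space M"
      then have w: "cmod w < 1" by (simp add: space_disk[OF M])
      have "(\<integral>\<^sup>+v. F n w v \<partial>lborel)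
          \<le> (\<integral>\<^sup>+v. ennreal (B * ln 2) * indicator (cball 0 4) (v :: complex) * indicator (ball 0 ((1 + s) / 2)) w \<partial>lborel)"
        by (rule nn_integral_mono) (rule F_le[OF w])
      also have "\<dots> = ?W w" by (simp add: nn_integral_cmult nn_integral_multc)
      finally show "(\<integral>\<^sup>+v. F n w v \<partial>lborel) \<le> ?W w" .
    qed
    have "ball 0 ((1 + s) / 2) \<in> sets M"
      using M s unfolding disk_measure_def by (auto simp: sets_restrict_space_iff)
    then have "(\<integral>\<^sup>+w. ?W w \<partial>M) = ennreal (B * ln 2) * emeasure lborel (cball (0 :: complex) 4) * emeasure M (ball 0 ((1 + s) / 2))"
      by (rule nn_integral_cmult_indicator)
    also have "\<dots> < \<infinity>"
      using fin[of "(1 + s) / 2"] s by (simp add: emeasure_cball ennreal_mult_less_top)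
    finally show "(\<integral>\<^sup>+w. ?W w \<partial>M) < \<infinity>" .
    show "AE w in M. (\<lambda>n. \<integral>\<^sup>+v. F n w v \<partial>lborel) \<longlonglongrightarrow> ennreal (f w * (1 - (cmod w)\<^sup>2)\<^sup>2) * collar_mass"
      using inner by (intro AE_I2) (simp add: space_disk[OF M])
  qed
  also have "(\<integral>\<^sup>+w. ennreal (f w * (1 - (cmod w)\<^sup>2)\<^sup>2) * collar_mass \<partial>M)
      = (\<integral>\<^sup>+w. ennreal (f w * (1 - (cmod w)\<^sup>2)\<^sup>2) \<partial>M) * collar_mass"
    by (intro nn_integral_multc measurable_disk[OF M]) measurable
  finally show ?thesis unfolding F_def .
qed

section \<open>Bounded Green potentials determine their measure\<close>

lemma sets_disk_measure_open:
  assumes "disk_measure M" "open U" "U \<subseteq> ball 0 s" "s \<le> 1"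
  shows "U \<in> sets M"
proof -
  have "U \<subseteq> unit_disk" using assms(3) subset_ball[OF assms(4)] by (rule order_trans)
  then show ?thesis
    using assms(1,2) unfolding disk_measure_def by (simp add: sets_restrict_space_iff)
qed

text \<open>Since \<open>g 0 w = ln (1 / |w|)\<close> is bounded below by a positive constant on a smaller disc, a finite potential at the origin bounds
  the mass of that disc.\<close>

lemma emeasure_ball_finite:
  assumes M: "disk_measure M" and bound: "green_potential M 0 \<le> ennreal C" and s: "s < 1"
  shows "emeasure M (ball 0 s) < \<infinity>"
proof (cases "0 < s")
  case True
  have ball: "ball 0 s \<in> sets M"
    using s by (intro sets_disk_measure_open[OF M, of _ s]) auto
  have "ennreal (ln (1 / s)) * emeasure M (ball 0 s) = (\<integral>\<^sup>+w. ennreal (ln (1 / s)) * indicator (ball 0 s) w \<partial>M)"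
    using ball by (simp add: nn_integral_cmult_indicator)
  also have "\<dots> \<le> green_potential M 0"
    unfolding green_potential_def
  proof (intro nn_integral_mono)
    fix w :: complex
    show "ennreal (ln (1 / s)) * indicator (ball 0 s) w \<le> green 0 w"
    proof (cases "w = 0 \<or> s \<le> cmod w")
      case False
      then have "1 / s \<le> 1 / cmod w" using True by (intro divide_left_mono) auto
      then have "ln (1 / s) \<le> ln (1 / cmod w)" using True False by (intro ln_mono) auto
      then show ?thesis using False by (auto simp: green_def norm_divide intro: ennreal_leI)
    qed (auto simp: green_def)
  qed
  also note bound
  finally have "ennreal (ln (1 / s)) * emeasure M (ball 0 s) < \<infinity>" by (simp add: le_less_trans)
  moreover have "0 < ln (1 / s)" using True s by (simp add: ln_gt_zero)
  ultimately show ?thesis by (auto simp: ennreal_mult_less_top)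
qed (auto simp: ball_empty)

lemma ex_ball_containing:
  assumes "cmod w < 1" shows "\<exists>n. w \<in> ball 0 (1 - 1 / real (Suc n))"
proof -
  obtain n where "1 / real (Suc n) < 1 - cmod w" using assms nat_approx_posE[of "1 - cmod w"] by auto
  then have "w \<in> ball 0 (1 - 1 / real (Suc n))" by simp
  then show ?thesis ..
qed

lemma sigma_finite_of_finite_on_balls:
  assumes M: "disk_measure M" and fin: "\<And>s. s < 1 \<Longrightarrow> emeasure M (ball 0 s) < \<infinity>"
  shows "sigma_finite_measure M"
proof
  let ?A = "range (\<lambda>n. ball 0 (1 - 1 / real (Suc n))) :: complex set set"
  have "?A \<subseteq> sets M"
    by (intro image_subsetI sets_disk_measure_open[OF M, OF _ order_refl]) auto
  moreover have "\<Union>?A = space M"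
    unfolding space_disk[OF M]
  proof (intro equalityI subsetI)
    fix w assume "w \<in> \<Union>?A"
    then obtain n where "cmod w < 1 - 1 / real (Suc n)" by auto
    also have "\<dots> < 1" by simp
    finally show "w \<in> unit_disk" by simp
  qed (use ex_ball_containing in auto)
  moreover have "\<forall>a\<in>?A. emeasure M a \<noteq> \<infinity>"
  proof (intro ballI, elim imageE)
    fix a n assume a: "a = ball (0 :: complex) (1 - 1 / real (Suc n))"
    have "emeasure M a < \<infinity>" unfolding a by (rule fin) simp
    then show "emeasure M a \<noteq> \<infinity>" by simp
  qed
  moreover have "countable ?A" by (intro countable_image countableI_type)
  ultimately show "\<exists>A. countable A \<and> A \<subseteq> sets M \<and> \<Union>A = space M \<and> (\<forall>a\<in>A. emeasure M a \<noteq> \<infinity>)"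
    by blast
qed

text \<open>The order of integration is exchanged; then, for fixed \<open>w\<close>, the substitution \<open>a = w + \<rho> v\<close> turns the
  pseudohyperbolic distance over \<open>\<rho>\<close> into \<open>|v| / |1 - cnj a \<cdot> w|\<close>.\<close>

lemma collar_smoothing_swap:
  assumes L: "disk_measure L" "sigma_finite_measure L" and \<rho>: "0 < \<rho>"
    and f [measurable]: "f \<in> borel_measurable borel" and f_nonneg: "\<And>z. 0 \<le> f z"
    and f_supp: "\<And>z. 1 \<le> cmod z \<Longrightarrow> f z = 0"
  shows "ennreal (\<rho>\<^sup>2) * (\<integral>\<^sup>+w. (\<integral>\<^sup>+v. ennreal (f (w + of_real \<rho> * v)
            * collar (cmod v / cmod (1 - cnj (w + of_real \<rho> * v) * w))) \<partial>lborel) \<partial>L)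
       = (\<integral>\<^sup>+a. ennreal (f a) * (\<integral>\<^sup>+w. ennreal (collar (cmod (disk_auto a w) / \<rho>)) \<partial>L) \<partial>lborel)"
proof -
  interpret L: sigma_finite_measure L by fact
  interpret P: pair_sigma_finite lborel L ..
  let ?k = "\<lambda>a w. ennreal (f a * collar (cmod (disk_auto a w) / \<rho>))"
  have mk: "(\<lambda>(a, w). ?k a w) \<in> borel_measurable (borel \<Otimes>\<^sub>M borel)"
    unfolding disk_auto_def by measurable
  have mk': "(\<lambda>a. ?k a w) \<in> borel_measurable borel" for w
    unfolding disk_auto_def by measurable
  have "(\<integral>\<^sup>+a. ennreal (f a) * (\<integral>\<^sup>+w. ennreal (collar (cmod (disk_auto a w) / \<rho>)) \<partial>L) \<partial>lborel)
      = (\<integral>\<^sup>+a. (\<integral>\<^sup>+w. ?k a w \<partial>L) \<partial>lborel)"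
  proof (rule nn_integral_cong)
    fix a :: complex
    have "(\<lambda>w. ennreal (collar (cmod (disk_auto a w) / \<rho>))) \<in> borel_measurable L"
      by (rule measurable_disk[OF L(1)], unfold disk_auto_def) measurable
    then show "ennreal (f a) * (\<integral>\<^sup>+w. ennreal (collar (cmod (disk_auto a w) / \<rho>)) \<partial>L) = (\<integral>\<^sup>+w. ?k a w \<partial>L)"
      by (simp add: nn_integral_cmult[symmetric] ennreal_mult f_nonneg collar_nonneg)
  qed
  also have "\<dots> = (\<integral>\<^sup>+w. (\<integral>\<^sup>+a. ?k a w \<partial>lborel) \<partial>L)"
    by (rule P.Fubini'[symmetric], rule measurable_pair_disk[OF L(1) _ mk]) simp
  also have "\<dots> = (\<integral>\<^sup>+w. ennreal (\<rho>\<^sup>2) * (\<integral>\<^sup>+v. ennreal (f (w + of_real \<rho> * v)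
            * collar (cmod v / cmod (1 - cnj (w + of_real \<rho> * v) * w))) \<partial>lborel) \<partial>L)"
  proof (rule nn_integral_cong)
    fix w assume "w \<in> space L"
    have "(\<integral>\<^sup>+a. ?k a w \<partial>lborel) = ennreal (\<rho>\<^sup>2) * (\<integral>\<^sup>+v. ?k (w + of_real \<rho> * v) w \<partial>lborel)"
      by (rule nn_integral_complex_affine[OF mk' \<rho>])
    also have "(\<lambda>v. ?k (w + of_real \<rho> * v) w) = (\<lambda>v. ennreal (f (w + of_real \<rho> * v)
            * collar (cmod v / cmod (1 - cnj (w + of_real \<rho> * v) * w))))"
      using \<rho> by (simp add: disk_auto_def norm_divide norm_mult fun_eq_iff)
    finally show "(\<integral>\<^sup>+a. ?k a w \<partial>lborel) = ennreal (\<rho>\<^sup>2) * (\<integral>\<^sup>+v. ennreal (f (w + of_real \<rho> * v)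
            * collar (cmod v / cmod (1 - cnj (w + of_real \<rho> * v) * w))) \<partial>lborel)" .
  qed
  also have "\<dots> = ennreal (\<rho>\<^sup>2) * (\<integral>\<^sup>+w. (\<integral>\<^sup>+v. ennreal (f (w + of_real \<rho> * v)
            * collar (cmod v / cmod (1 - cnj (w + of_real \<rho> * v) * w))) \<partial>lborel) \<partial>L)"
    by (intro nn_integral_cmult measurable_disk[OF L(1)]) measurable
  finally show ?thesis ..
qed

context
  fixes M N :: "complex measure" and C :: real
  assumes M: "disk_measure M" and N: "disk_measure N"
    and eq: "\<And>z. cmod z < 1 \<Longrightarrow> green_potential M z = green_potential N z"
    and bounded: "\<And>z. cmod z < 1 \<Longrightarrow> green_potential M z \<le> ennreal C"
begin

lemma emeasure_balls_finite: "s < 1 \<Longrightarrow> emeasure M (ball 0 s) < \<infinity>" "s < 1 \<Longrightarrow> emeasure N (ball 0 s) < \<infinity>"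
  using emeasure_ball_finite[OF M, of C s] emeasure_ball_finite[OF N, of C s] bounded[of 0] eq[of 0] by auto

lemma sigma_finite_both: "sigma_finite_measure M" "sigma_finite_measure N"
  using sigma_finite_of_finite_on_balls M N emeasure_balls_finite by blast+

text \<open>Integrating the bumps centred at \<open>a\<close> against \<open>f a da\<close> gives equal numbers for both measures at every
  scale; by the approximate identity they converge to the two sides, up to the common factor \<open>collar_mass\<close>.\<close>

lemma test_integrals_eq:
  assumes f [measurable]: "f \<in> borel_measurable borel" and f_bound: "\<And>z. 0 \<le> f z \<and> f z \<le> B"
    and s: "0 < s" "s < 1" and f_supp: "\<And>z. s \<le> cmod z \<Longrightarrow> f z = 0"
    and f_cont: "\<And>z. cmod z < 1 \<Longrightarrow> isCont f z"
  shows "(\<integral>\<^sup>+w. ennreal (f w * (1 - (cmod w)\<^sup>2)\<^sup>2) \<partial>M) = (\<integral>\<^sup>+w. ennreal (f w * (1 - (cmod w)\<^sup>2)\<^sup>2) \<partial>N)"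
proof -
  define \<rho> where "\<rho> n = (1 - s) / real (n + 1) / 8" for n
  define J where "J L n = (\<integral>\<^sup>+w. (\<integral>\<^sup>+v. ennreal (f (w + of_real (\<rho> n) * v)
            * collar (cmod v / cmod (1 - cnj (w + of_real (\<rho> n) * v) * w))) \<partial>lborel) \<partial>L)"
    for L :: "complex measure" and n
  have \<rho>_pos: "0 < \<rho> n" for n using s by (simp add: \<rho>_def)
  have \<rho>_less: "\<rho> n < 1 / 2" for n
  proof -
    define q where "q = (1 - s) / real (n + 1)"
    have "q \<le> (1 - s) / 1"
      unfolding q_def using s by (intro divide_left_mono) auto
    moreover have "\<rho> n = q / 8" by (simp only: \<rho>_def q_def)
    ultimately show ?thesis using s by simp
  qed
  have supp: "f z = 0" if "1 \<le> cmod z" for z using f_supp that s by simp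
  have "J M = J N"
  proof
    fix n
    have "ennreal ((\<rho> n)\<^sup>2) * J M n
        = (\<integral>\<^sup>+a. ennreal (f a) * (\<integral>\<^sup>+w. ennreal (collar (cmod (disk_auto a w) / \<rho> n)) \<partial>M) \<partial>lborel)"
      unfolding J_def using f_bound supp by (intro collar_smoothing_swap M sigma_finite_both \<rho>_pos) auto
    also have "\<dots> = (\<integral>\<^sup>+a. ennreal (f a) * (\<integral>\<^sup>+w. ennreal (collar (cmod (disk_auto a w) / \<rho> n)) \<partial>N) \<partial>lborel)"
    proof (rule nn_integral_cong)
      fix a
      show "ennreal (f a) * (\<integral>\<^sup>+w. ennreal (collar (cmod (disk_auto a w) / \<rho> n)) \<partial>M)
          = ennreal (f a) * (\<integral>\<^sup>+w. ennreal (collar (cmod (disk_auto a w) / \<rho> n)) \<partial>N)"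
      proof (cases "cmod a < 1")
        case True
        show ?thesis
          using collar_integral_determined_by_potential[OF M sigma_finite_both(1) N sigma_finite_both(2) eq bounded True \<rho>_pos \<rho>_less]
          by simp
      qed (simp add: supp)
    qed
    also have "\<dots> = ennreal ((\<rho> n)\<^sup>2) * J N n"
      unfolding J_def using f_bound supp by (intro collar_smoothing_swap[symmetric] N sigma_finite_both \<rho>_pos) auto
    finally show "J M n = J N n"
      using \<rho>_pos[of n] by (simp add: ennreal_mult_cancel_left)
  qed
  moreover have "J M \<longlonglongrightarrow> (\<integral>\<^sup>+w. ennreal (f w * (1 - (cmod w)\<^sup>2)\<^sup>2) \<partial>M) * collar_mass"
    using collar_approximate_identity[OF M emeasure_balls_finite(1) f f_bound s f_supp f_cont]
    unfolding J_def \<rho>_def .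
  moreover have "J N \<longlonglongrightarrow> (\<integral>\<^sup>+w. ennreal (f w * (1 - (cmod w)\<^sup>2)\<^sup>2) \<partial>N) * collar_mass"
    using collar_approximate_identity[OF N emeasure_balls_finite(2) f f_bound s f_supp f_cont]
    unfolding J_def \<rho>_def .
  ultimately have "(\<integral>\<^sup>+w. ennreal (f w * (1 - (cmod w)\<^sup>2)\<^sup>2) \<partial>M) * collar_mass
      = (\<integral>\<^sup>+w. ennreal (f w * (1 - (cmod w)\<^sup>2)\<^sup>2) \<partial>N) * collar_mass"
    by (simp add: LIMSEQ_unique)
  then have "collar_mass * (\<integral>\<^sup>+w. ennreal (f w * (1 - (cmod w)\<^sup>2)\<^sup>2) \<partial>M)
      = collar_mass * (\<integral>\<^sup>+w. ennreal (f w * (1 - (cmod w)\<^sup>2)\<^sup>2) \<partial>N)"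
    by (simp add: mult.commute)
  then show ?thesis
    using collar_mass_finite collar_mass_pos by (auto simp: ennreal_mult_cancel_left)
qed

text \<open>The indicator of \<open>U\<close> is the increasing limit of the continuous functions \<open>h k\<close>. Dividing them by
  \<open>(1 - |w|\<^sup>2)\<^sup>2\<close> compensates for the weight in the preceding lemma.\<close>

lemma emeasure_open_eq:
  assumes U: "open U" "U \<subseteq> ball 0 s" and s: "0 < s" "s < 1"
  shows "emeasure M U = emeasure N U"
proof -
  define h where "h k w = min 1 (real k * infdist w (- U))" for k and w :: complex
  have U_sets: "U \<in> sets L" if "disk_measure L" for L
    using sets_disk_measure_open[OF that U] s by simp
  have "1 \<notin> ball (0 :: complex) s" using s by simp
  then have nonempty: "- U \<noteq> {}" using U by blast
  have h0: "0 \<le> h k w" "h k w \<le> 1" for k w by (auto simp: h_def infdist_nonneg)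
  have h_out: "h k w = 0" if "w \<notin> U" for k w using that by (simp add: h_def infdist_zero)
  have [measurable]: "h k \<in> borel_measurable borel" for k
    unfolding h_def by (intro borel_measurable_continuous_onI continuous_intros continuous_on_infdist)
  have "(\<integral>\<^sup>+w. ennreal (h k w) \<partial>M) = (\<integral>\<^sup>+w. ennreal (h k w) \<partial>N)" for k
  proof -
    define f where "f w = h k w / (1 - (cmod w)\<^sup>2)\<^sup>2" for w
    have "(\<integral>\<^sup>+w. ennreal (f w * (1 - (cmod w)\<^sup>2)\<^sup>2) \<partial>M) = (\<integral>\<^sup>+w. ennreal (f w * (1 - (cmod w)\<^sup>2)\<^sup>2) \<partial>N)"
    proof (rule test_integrals_eq[OF _ _ s])
      show "f \<in> borel_measurable borel" unfolding f_def by measurable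
      show "f z = 0" if "s \<le> cmod z" for z using that U by (auto simp: f_def intro!: h_out)
      show "0 \<le> f z \<and> f z \<le> 1 / (1 - s\<^sup>2)\<^sup>2" for z
      proof (cases "cmod z < s")
        case True
        have "s\<^sup>2 < 1" using s by (simp add: abs_square_less_1)
        moreover have "(cmod z)\<^sup>2 \<le> s\<^sup>2" using True by (intro power_mono) auto
        ultimately have "f z \<le> 1 / (1 - s\<^sup>2)\<^sup>2"
          unfolding f_def using h0 by (intro frac_le power_mono) auto
        then show ?thesis using h0 by (simp add: f_def)
      next
        case False
        then show ?thesis using U by (auto simp: f_def h_out subset_eq)
      qed
      show "isCont f z" if "cmod z < 1" for z
        unfolding f_def h_def using that abs_square_less_1[of "cmod z"]
        by (intro continuous_intros continuous_infdist) auto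
    qed
    moreover have "(\<integral>\<^sup>+w. ennreal (f w * (1 - (cmod w)\<^sup>2)\<^sup>2) \<partial>L) = (\<integral>\<^sup>+w. ennreal (h k w) \<partial>L)"
      if L: "disk_measure L" for L
    proof (rule nn_integral_cong)
      fix w assume "w \<in> space L"
      then have "(cmod w)\<^sup>2 < 1" by (simp add: space_disk[OF L] abs_square_less_1)
      then show "ennreal (f w * (1 - (cmod w)\<^sup>2)\<^sup>2) = ennreal (h k w)" by (simp add: f_def)
    qed
    ultimately show ?thesis using M N by simp
  qed
  then have eq_h: "(\<lambda>k. \<integral>\<^sup>+w. ennreal (h k w) \<partial>M) = (\<lambda>k. \<integral>\<^sup>+w. ennreal (h k w) \<partial>N)"
    by (rule ext)
  have lim: "(\<lambda>k. \<integral>\<^sup>+w. ennreal (h k w) \<partial>L) \<longlonglongrightarrow> emeasure L U" if L: "disk_measure L" for L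
  proof -
    have "(\<lambda>k. \<integral>\<^sup>+w. ennreal (h k w) \<partial>L) \<longlonglongrightarrow> (\<integral>\<^sup>+w. indicator U w \<partial>L)"
    proof (rule nn_integral_LIMSEQ)
      show "incseq (\<lambda>k w. ennreal (h k w))"
        by (intro incseq_SucI le_funI ennreal_leI)
           (auto simp: h_def min_def algebra_simps infdist_nonneg intro: add_increasing)
      show "(\<lambda>w. ennreal (h k w)) \<in> borel_measurable L" for k
        by (rule measurable_disk[OF L]) measurable
      fix w
      show "(\<lambda>k. ennreal (h k w)) \<longlonglongrightarrow> indicator U w"
      proof (cases "w \<in> U")
        case True
        have "0 < infdist w (- U)"
          using True U nonempty in_closed_iff_infdist_zero[of "- U" w] infdist_nonneg[of w "- U"]
          by (auto simp: less_le)
        then obtain n where n: "1 < real n * infdist w (- U)" using reals_Archimedean3 by blast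
        have "\<forall>\<^sub>F k in sequentially. ennreal (h k w) = indicator U w"
          using eventually_ge_at_top[of n]
        proof eventually_elim
          case (elim k)
          then have "real n * infdist w (- U) \<le> real k * infdist w (- U)"
            by (intro mult_right_mono infdist_nonneg) simp
          then show ?case using n True by (simp add: h_def min_def)
        qed
        then show ?thesis by (rule tendsto_eventually)
      qed (simp add: h_out)
    qed
    then show ?thesis using U_sets[OF L] by simp
  qed
  show ?thesis using lim[OF M] lim[OF N] unfolding eq_h by (rule LIMSEQ_unique)
qed

text \<open>The open sets inside smaller concentric discs are closed under intersection, generate the Borel sets
  of the disc, and have finite measure.\<close>

theorem green_potential_inject: "M = N"
proof (rule measure_eqI_generator_eq[where \<Omega>=unit_disk])
  let ?E = "{U :: complex set. open U \<and> (\<exists>s. 0 < s \<and> s < 1 \<and> U \<subseteq> ball 0 s)}"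
  let ?A = "\<lambda>n. ball 0 (1 - 1 / real (n + 2)) :: complex set"
  show "Int_stable ?E"
  proof (rule Int_stableI)
    fix U V assume "U \<in> ?E" "V \<in> ?E"
    then obtain s where "open U" "open V" "0 < s" "s < 1" "U \<subseteq> ball 0 s" by auto
    then show "U \<inter> V \<in> ?E" by (auto intro!: exI[of _ s])
  qed
  show E_Pow: "?E \<subseteq> Pow unit_disk"
  proof
    fix U assume "U \<in> ?E"
    then obtain s where "s < 1" "U \<subseteq> ball 0 s" by auto
    then show "U \<in> Pow unit_disk" using subset_ball[of s 1 "0 :: complex"] by auto
  qed
  show "emeasure M X = emeasure N X" if "X \<in> ?E" for X
    using that emeasure_open_eq by blast
  show A: "range ?A \<subseteq> ?E"
  proof (intro image_subsetI CollectI conjI exI)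
    fix n
    show "0 < 1 - 1 / real (n + 2)" by simp
    show "1 - 1 / real (n + 2) < 1" by simp
  qed auto
  show UN: "(\<Union>i. ?A i) = unit_disk"
  proof (intro equalityI subsetI)
    fix w :: complex assume "w \<in> unit_disk"
    then obtain n where "w \<in> ball 0 (1 - 1 / real (Suc n))" using ex_ball_containing by auto
    moreover have "1 / real (n + 2) \<le> 1 / real (Suc n)" by (intro divide_left_mono) auto
    ultimately have "w \<in> ?A n" by simp
    then show "w \<in> (\<Union>i. ?A i)" by blast
  qed (use A E_Pow in blast)
  show "emeasure M (?A i) \<noteq> \<infinity>" for i
    using emeasure_balls_finite(1)[of "1 - 1 / real (i + 2)"] by auto
  have "sets (restrict_space borel unit_disk) = sigma_sets unit_disk ?E"
  proof (rule antisym)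
    have "sets (restrict_space borel unit_disk) = sigma_sets unit_disk ((\<inter>) unit_disk ` {U. open U})"
      unfolding sets_restrict_space sets_borel
      by (intro sigma_sets_Int sigma_sets.Basic) auto
    also have "\<dots> \<subseteq> sigma_sets unit_disk ?E"
    proof (rule sigma_sets_mono, clarify)
      fix U :: "complex set" assume "open U"
      then have "U \<inter> ?A n \<in> ?E" for n
        using A by (auto intro!: exI[of _ "1 - 1 / real (n + 2)"])
      then have "(\<Union>n. U \<inter> ?A n) \<in> sigma_sets unit_disk ?E"
        by (intro sigma_sets.Union sigma_sets.Basic)
      also have "(\<Union>n. U \<inter> ?A n) = unit_disk \<inter> U" using UN by blast
      finally show "unit_disk \<inter> U \<in> sigma_sets unit_disk ?E" .
    qed
    finally show "sets (restrict_space borel unit_disk) \<subseteq> sigma_sets unit_disk ?E" .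
    show "sigma_sets unit_disk ?E \<subseteq> sets (restrict_space borel unit_disk)"
    proof (rule sets.sigma_sets_subset')
      show "?E \<subseteq> sets (restrict_space borel unit_disk)"
        using E_Pow by (auto simp: sets_restrict_space_iff)
      show "unit_disk \<in> sets (restrict_space borel unit_disk)"
        by (simp add: sets_restrict_space_iff)
    qed
  qed
  then show "sets M = sigma_sets unit_disk ?E" "sets N = sigma_sets unit_disk ?E"
    using M N by (simp_all add: disk_measure_def)
qed

end

section \<open>Polar coordinates in the plane\<close>

text \<open>A translation invariant measure that agrees with Lebesgue measure on the unit disc is Lebesgue
  measure; the rotated measure has both properties. Concretely, \<open>1\<^sub>B x \<cdot> f (u x + y)\<close> is integrated over \<open>x\<close> and
  \<open>y\<close>, where \<open>B\<close> is the unit disc: first over \<open>y\<close>, and then, after shifting \<open>x\<close> by \<open>- y / u\<close>, again first over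
  \<open>y\<close>, where \<open>y\<close> now only enters through a disc of radius 1 about \<open>u x\<close>.\<close>

lemma nn_integral_rotation:
  fixes f :: "complex \<Rightarrow> ennreal"
  assumes [measurable]: "f \<in> borel_measurable borel" and u: "cmod u = 1"
  shows "(\<integral>\<^sup>+x. f (u * x) \<partial>lborel) = (\<integral>\<^sup>+x. f x \<partial>lborel)"
proof -
  let ?B = "indicator (ball 0 1) :: complex \<Rightarrow> ennreal"
  define b where "b = emeasure lborel (ball (0 :: complex) 1)"
  have b: "b \<noteq> 0" "b \<noteq> \<infinity>"
    by (simp_all add: b_def emeasure_ball unit_ball_vol_2)
  have [measurable]: "ball (0 :: complex) 1 \<in> sets borel" by simp
  have shift: "(\<integral>\<^sup>+x. g (t + x) \<partial>lborel) = (\<integral>\<^sup>+x. g x \<partial>lborel)"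
    if "g \<in> borel_measurable borel" for g :: "complex \<Rightarrow> ennreal" and t
    using nn_integral_complex_affine[OF that, of 1 t] by simp
  have "u \<noteq> 0" using u by auto
  have "b * (\<integral>\<^sup>+x. f x \<partial>lborel) = (\<integral>\<^sup>+x. ?B x * (\<integral>\<^sup>+y. f y \<partial>lborel) \<partial>lborel)"
    unfolding b_def by (subst nn_integral_multc) auto
  also have "\<dots> = (\<integral>\<^sup>+x. (\<integral>\<^sup>+y. ?B x * f (u * x + y) \<partial>lborel) \<partial>lborel)"
    by (intro nn_integral_cong, subst nn_integral_cmult) (auto simp: shift)
  also have "\<dots> = (\<integral>\<^sup>+y. (\<integral>\<^sup>+x. ?B x * f (u * x + y) \<partial>lborel) \<partial>lborel)"
    by (rule lborel_pair.Fubini'[symmetric]) measurable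
  also have "\<dots> = (\<integral>\<^sup>+y. (\<integral>\<^sup>+x. ?B (- y / u + x) * f (u * x) \<partial>lborel) \<partial>lborel)"
  proof (rule nn_integral_cong)
    fix y
    have "(\<integral>\<^sup>+x. ?B x * f (u * x + y) \<partial>lborel) = (\<integral>\<^sup>+x. ?B (- y / u + x) * f (u * (- y / u + x) + y) \<partial>lborel)"
      by (rule shift[of "\<lambda>x. ?B x * f (u * x + y)", symmetric]) measurable
    then show "(\<integral>\<^sup>+x. ?B x * f (u * x + y) \<partial>lborel) = (\<integral>\<^sup>+x. ?B (- y / u + x) * f (u * x) \<partial>lborel)"
      using \<open>u \<noteq> 0\<close> by (simp add: distrib_left right_diff_distrib)
  qed
  also have "\<dots> = (\<integral>\<^sup>+x. (\<integral>\<^sup>+y. ?B (- y / u + x) * f (u * x) \<partial>lborel) \<partial>lborel)"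
    by (rule lborel_pair.Fubini') measurable
  also have "\<dots> = (\<integral>\<^sup>+x. b * f (u * x) \<partial>lborel)"
  proof (rule nn_integral_cong)
    fix x
    have "cmod (y / u - x) = cmod (u * x - y)" for y
    proof -
      have "y / u - x = - ((u * x - y) / u)" using \<open>u \<noteq> 0\<close> by (simp add: field_simps)
      then have "cmod (y / u - x) = cmod ((u * x - y) / u)" by (simp only: norm_minus_cancel)
      then show ?thesis using u by (simp add: norm_divide)
    qed
    then have "?B (- y / u + x) = indicator (ball (u * x) 1) y" for y
      by (simp add: indicator_def dist_norm)
    then have "(\<integral>\<^sup>+y. ?B (- y / u + x) * f (u * x) \<partial>lborel) = emeasure lborel (ball (u * x) 1) * f (u * x)"
      by (simp add: nn_integral_multc borel_measurable_indicator)
    then show "(\<integral>\<^sup>+y. ?B (- y / u + x) * f (u * x) \<partial>lborel) = b * f (u * x)"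
      by (simp add: b_def emeasure_ball)
  qed
  also have "\<dots> = b * (\<integral>\<^sup>+x. f (u * x) \<partial>lborel)"
    by (rule nn_integral_cmult) measurable
  finally show ?thesis using b by (auto simp: ennreal_mult_cancel_left)
qed

lemma nn_integral_angular_mean:
  fixes f :: "complex \<Rightarrow> ennreal"
  assumes [measurable]: "f \<in> borel_measurable borel"
  shows "(\<integral>\<^sup>+w. f w \<partial>lborel) = (\<integral>\<^sup>+w. (\<integral>\<^sup>+t. f (w * unit_pt t) \<partial>turn) \<partial>lborel)"
proof -
  interpret P: pair_sigma_finite turn "lborel :: complex measure" ..
  have "(\<integral>\<^sup>+w. f w \<partial>lborel) = (\<integral>\<^sup>+t. (\<integral>\<^sup>+w. f w \<partial>lborel) \<partial>turn)" by simp
  also have "\<dots> = (\<integral>\<^sup>+t. (\<integral>\<^sup>+w. f (w * unit_pt t) \<partial>lborel) \<partial>turn)"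
    using nn_integral_rotation[OF assms, of "unit_pt _"]
    by (simp only: mult.commute[of "unit_pt _"] norm_cis)
  also have "\<dots> = (\<integral>\<^sup>+w. (\<integral>\<^sup>+t. f (w * unit_pt t) \<partial>turn) \<partial>lborel)"
    by (rule P.Fubini'[symmetric]) measurable
  finally show ?thesis .
qed

text \<open>Both measures give \<open>{..a}\<close> the area of the disc of radius \<open>a\<close>. The density vanishes on the negative
  axis because \<open>ennreal\<close> truncates.\<close>

lemma distr_cmod_lborel: "distr lborel borel cmod = density lborel (\<lambda>t. ennreal (2 * pi * t))"
proof (rule measure_eqI_generator_eq)
  let ?E = "range (\<lambda>a :: real. {..a})"
  have cmod_vimage: "cmod -` {..a} = cball 0 a" for a by auto
  show "Int_stable ?E" by (auto simp: Int_stable_def)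
  show "?E \<subseteq> Pow UNIV" by simp
  show "sets (distr lborel borel cmod) = sigma_sets UNIV ?E"
    "sets (density lborel (\<lambda>t. ennreal (2 * pi * t))) = sigma_sets UNIV ?E"
    by (simp_all add: borel_eq_atMost)
  show "emeasure (distr lborel borel cmod) X = emeasure (density lborel (\<lambda>t. ennreal (2 * pi * t))) X"
    if X: "X \<in> ?E" for X
  proof -
    from X obtain a where X: "X = {..a}" by auto
    have "emeasure (density lborel (\<lambda>t. ennreal (2 * pi * t))) X
        = (\<integral>\<^sup>+t. ennreal (2 * pi * t) * indicator {0..a} t \<partial>lborel)"
      unfolding X by (subst emeasure_density) (auto intro!: nn_integral_cong split: split_indicator simp: ennreal_neg mult_nonneg_nonpos)
    moreover have "emeasure (distr lborel borel cmod) X = emeasure lborel (cball (0 :: complex) a)"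
      unfolding X by (subst emeasure_distr) (auto simp: cmod_vimage)
    moreover have "emeasure lborel (cball (0 :: complex) a) = (\<integral>\<^sup>+t. ennreal (2 * pi * t) * indicator {0..a} t \<partial>lborel)"
    proof (cases "0 \<le> a")
      case True
      then have "(\<integral>\<^sup>+t. ennreal (2 * pi * t) * indicator {0..a} t \<partial>lborel) = ennreal (pi * a\<^sup>2 - pi * 0\<^sup>2)"
        by (intro nn_integral_FTC_Icc) (auto intro!: derivative_eq_intros)
      then show ?thesis using True by (simp add: emeasure_cball unit_ball_vol_2)
    qed simp
    ultimately show ?thesis by simp
  qed
  show "range (\<lambda>i :: nat. {..real i}) \<subseteq> ?E" by auto
  show "(\<Union>i :: nat. {..real i}) = UNIV" using real_arch_simple by auto
  show "emeasure (distr lborel borel cmod) {..real i} \<noteq> \<infinity>" for i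
    by (subst emeasure_distr) (auto simp: cmod_vimage emeasure_cball)
qed

lemma nn_integral_radial:
  assumes [measurable]: "h \<in> borel_measurable borel"
  shows "(\<integral>\<^sup>+w. h (cmod w) \<partial>lborel) = (\<integral>\<^sup>+t. ennreal (2 * pi * t) * h t \<partial>lborel)"
proof -
  have "(\<integral>\<^sup>+w. h (cmod w) \<partial>lborel) = (\<integral>\<^sup>+t. h t \<partial>distr lborel borel cmod)"
    by (subst nn_integral_distr) auto
  also have "\<dots> = (\<integral>\<^sup>+t. ennreal (2 * pi * t) * h t \<partial>lborel)"
    unfolding distr_cmod_lborel by (subst nn_integral_density) auto
  finally show ?thesis .
qed

section \<open>The Riesz measure of the infimum of the Green function\<close>

definition green_inf_profile :: "real \<Rightarrow> real \<Rightarrow> real" where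
  "green_inf_profile r t = ln ((1 + r * t) / (t + r))"

text \<open>The mass of the disc of radius \<open>t\<close> under \<open>riesz_measure r\<close>. It equals \<open>- t\<close> times the derivative of
  \<open>green_inf_profile r\<close> at \<open>t\<close>, as Gauss's law requires for a rotation invariant measure with potential
  \<open>green_inf_profile r\<close>.\<close>

definition riesz_mass :: "real \<Rightarrow> real \<Rightarrow> real" where
  "riesz_mass r t = (1 - r\<^sup>2) * t / ((1 + r * t) * (t + r))"

definition riesz_density :: "real \<Rightarrow> real \<Rightarrow> real" where
  "riesz_density r t = r * (1 - r\<^sup>2) * (1 - t\<^sup>2) / (2 * pi * t * (r * t + 1)\<^sup>2 * (r + t)\<^sup>2)"

definition riesz_measure :: "real \<Rightarrow> complex measure" where
  "riesz_measure r = density (restrict_space lborel unit_disk) (\<lambda>z. ennreal (riesz_density r (cmod z)))"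

context
  fixes r :: real
  assumes r: "0 < r" "r < 1"
begin

lemma radius_square_less_1: "r\<^sup>2 < 1" using r by (simp add: abs_square_less_1)

lemma green_inf_profile_deriv:
  assumes "0 \<le> t"
  shows "DERIV (green_inf_profile r) t :> - ((1 - r\<^sup>2) / ((1 + r * t) * (t + r)))"
proof -
  have pos: "0 < 1 + r * t" "0 < t + r" using r assms by (auto intro: add_pos_nonneg)
  have "DERIV (\<lambda>t. ln (1 + r * t) - ln (t + r)) t :> r / (1 + r * t) - 1 / (t + r)"
    using pos by (auto intro!: derivative_eq_intros)
  also have "r / (1 + r * t) - 1 / (t + r) = - ((1 - r\<^sup>2) / ((1 + r * t) * (t + r)))"
    using pos by (simp add: divide_simps) (simp add: algebra_simps power2_eq_square)
  finally show ?thesis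
  proof (rule has_field_derivative_transform_within_open[where S="{t. 0 < 1 + r * t} \<inter> {t. 0 < t + r}"])
    show "open ({t. 0 < 1 + r * t} \<inter> {t. 0 < t + r})"
      by (intro open_Int open_Collect_less continuous_intros)
  qed (use pos in \<open>auto simp: green_inf_profile_def ln_div\<close>)
qed

lemma riesz_mass_deriv:
  assumes "0 < t"
  shows "DERIV (riesz_mass r) t :> 2 * pi * t * riesz_density r t"
proof -
  define D where "D = (1 + r * t) * (t + r)"
  have pos: "0 < 1 + r * t" "0 < t + r" using r assms by (auto intro: add_pos_nonneg)
  then have D: "D \<noteq> 0" by (simp add: D_def)
  have "DERIV (riesz_mass r) t :> ((1 - r\<^sup>2) * D - (1 - r\<^sup>2) * t * (r * (t + r) + (1 + r * t))) / (D * D)"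
    unfolding riesz_mass_def D_def using pos by (auto intro!: derivative_eq_intros)
  also have "(1 - r\<^sup>2) * D - (1 - r\<^sup>2) * t * (r * (t + r) + (1 + r * t)) = r * (1 - r\<^sup>2) * (1 - t\<^sup>2)"
    by (simp add: D_def algebra_simps power2_eq_square)
  also have "r * (1 - r\<^sup>2) * (1 - t\<^sup>2) / (D * D) = 2 * pi * t * riesz_density r t"
  proof -
    have "2 * pi * t * (r * t + 1)\<^sup>2 * (r + t)\<^sup>2 = 2 * pi * t * (D * D)"
      by (simp add: D_def power2_eq_square algebra_simps)
    then have "riesz_density r t = r * (1 - r\<^sup>2) * (1 - t\<^sup>2) / (2 * pi * t * (D * D))"
      unfolding riesz_density_def by (simp only:)
    then show ?thesis using assms by simp
  qed
  finally show ?thesis .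
qed

lemma riesz_density_nonneg: "0 < t \<Longrightarrow> t \<le> 1 \<Longrightarrow> 0 \<le> riesz_density r t"
  using r radius_square_less_1 unfolding riesz_density_def
  by (intro divide_nonneg_nonneg mult_nonneg_nonneg) (auto simp: abs_square_le_1)

lemma riesz_density_measurable [measurable]: "riesz_density r \<in> borel_measurable borel"
  unfolding riesz_density_def by measurable

lemma disk_measure_riesz: "disk_measure (riesz_measure r)"
  by (simp add: disk_measure_def riesz_measure_def sets_restrict_space)

lemma nn_integral_riesz:
  assumes [measurable]: "f \<in> borel_measurable borel"
  shows "(\<integral>\<^sup>+w. f w \<partial>riesz_measure r)
       = (\<integral>\<^sup>+w. ennreal (riesz_density r (cmod w)) * indicator unit_disk w * f w \<partial>lborel)"
proof -
  have "(\<lambda>z. ennreal (riesz_density r (cmod z))) \<in> borel_measurable (restrict_space lborel unit_disk)"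
    by (intro measurable_restrict_space1) measurable
  moreover have "f \<in> borel_measurable (restrict_space lborel unit_disk)"
    by (intro measurable_restrict_space1) measurable
  ultimately show ?thesis
    unfolding riesz_measure_def
    by (simp add: nn_integral_density nn_integral_restrict_space mult_ac)
qed

lemma riesz_mass_of_ball:
  assumes x: "0 < x" "x \<le> 1"
  shows "(\<integral>\<^sup>+w. ennreal (riesz_density r (cmod w)) * indicator (ball 0 x) w \<partial>lborel) = ennreal (riesz_mass r x)"
proof -
  have "(\<integral>\<^sup>+w. ennreal (riesz_density r (cmod w)) * indicator (ball 0 x) w \<partial>lborel)
      = (\<integral>\<^sup>+w. ennreal (riesz_density r (cmod w)) * indicator {..<x} (cmod w) \<partial>lborel)"
    by (intro nn_integral_cong) (auto split: split_indicator)
  also have "\<dots> = (\<integral>\<^sup>+t. ennreal (2 * pi * t) * (ennreal (riesz_density r t) * indicator {..<x} t) \<partial>lborel)"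
    by (rule nn_integral_radial) measurable
  also have "\<dots> = (\<integral>\<^sup>+t. ennreal (2 * pi * t * riesz_density r t) * indicator {0<..<x} t \<partial>lborel)"
  proof (rule nn_integral_cong)
    fix t :: real
    consider "t \<le> 0" | "0 < t" "t < x" | "x \<le> t" by linarith
    then show "ennreal (2 * pi * t) * (ennreal (riesz_density r t) * indicator {..<x} t)
        = ennreal (2 * pi * t * riesz_density r t) * indicator {0<..<x} t"
    proof cases
      case 1
      then have "2 * pi * t \<le> 0" by (simp add: mult_nonneg_nonpos)
      then show ?thesis using 1 by (simp add: ennreal_neg)
    next
      case 2
      then have "0 \<le> riesz_density r t" using x by (intro riesz_density_nonneg) auto
      then show ?thesis using 2 by (simp add: ennreal_mult)
    qed simp
  qed
  also have "\<dots> = ennreal (riesz_mass r x)"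
  proof (rule nn_integral_FTC_half_open[where F="riesz_mass r"])
    have "(riesz_mass r \<longlongrightarrow> riesz_mass r 0) (at_right 0)"
      unfolding riesz_mass_def using r by (auto intro!: tendsto_eq_intros)
    then have "((\<lambda>y. ennreal (riesz_mass r x - riesz_mass r y)) \<longlongrightarrow> ennreal (riesz_mass r x - riesz_mass r 0)) (at_right 0)"
      by (intro tendsto_ennrealI tendsto_diff tendsto_const)
    then show "((\<lambda>y. ennreal (riesz_mass r x - riesz_mass r y)) \<longlongrightarrow> ennreal (riesz_mass r x)) (at_right 0)"
      by (simp add: riesz_mass_def)
    show "0 \<le> 2 * pi * t * riesz_density r t" if "0 < t" "t \<le> x" for t
      using that x riesz_density_nonneg[of t] by simp
  qed (use x in \<open>auto intro!: riesz_mass_deriv\<close>)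
  finally show ?thesis .
qed

lemma emeasure_riesz: "emeasure (riesz_measure r) unit_disk = ennreal ((1 - r) / (1 + r))"
proof -
  have "emeasure (riesz_measure r) unit_disk = (\<integral>\<^sup>+w. 1 \<partial>riesz_measure r)"
    using space_disk[OF disk_measure_riesz] by simp
  also have "\<dots> = ennreal (riesz_mass r 1)"
    using riesz_mass_of_ball[of 1] by (subst nn_integral_riesz) auto
  also have "riesz_mass r 1 = (1 - r) / (1 + r)"
  proof -
    have "1 - r\<^sup>2 = (1 - r) * (1 + r)" by (simp add: algebra_simps power2_eq_square)
    then show ?thesis using r by (simp add: riesz_mass_def)
  qed
  finally show ?thesis .
qed

text \<open>Averaging over angles replaces \<open>g z w\<close> by the integral of \<open>1 / x\<close> over \<open>max |z| |w| < x < 1\<close>. After Tonelli,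
  \<open>w\<close> ranges over the disc of radius \<open>x\<close>, which yields \<open>riesz_mass r x / x\<close>, minus the derivative of
  \<open>green_inf_profile r\<close>.\<close>

lemma green_potential_riesz:
  assumes z: "cmod z < 1"
  shows "green_potential (riesz_measure r) z = ennreal (green_inf_profile r (cmod z))"
proof -
  let ?d = "\<lambda>w. ennreal (riesz_density r (cmod w)) * indicator unit_disk w"
  have [measurable]: "unit_disk \<in> sets borel" by simp
  note [measurable] = measurable_green_right
  have "green_potential (riesz_measure r) z = (\<integral>\<^sup>+w. ?d w * green z w \<partial>lborel)"
    unfolding green_potential_def by (rule nn_integral_riesz) measurable
  also have "\<dots> = (\<integral>\<^sup>+w. (\<integral>\<^sup>+t. ?d (w * unit_pt t) * green z (w * unit_pt t) \<partial>turn) \<partial>lborel)"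
    by (rule nn_integral_angular_mean) measurable
  also have "\<dots> = (\<integral>\<^sup>+w. (\<integral>\<^sup>+x. ennreal (1 / x) * indicator {cmod z<..<1} x
      * (ennreal (riesz_density r (cmod w)) * indicator (ball 0 x) w) \<partial>lborel) \<partial>lborel)"
  proof (rule nn_integral_cong)
    fix w :: complex
    have "?d (w * unit_pt t) = ?d w" for t by (auto simp: norm_mult split: split_indicator)
    then have "(\<integral>\<^sup>+t. ?d (w * unit_pt t) * green z (w * unit_pt t) \<partial>turn)
        = (\<integral>\<^sup>+t. ?d w * green z (w * unit_pt t) \<partial>turn)" by simp
    also have "\<dots> = ?d w * (\<integral>\<^sup>+t. green z (w * unit_pt t) \<partial>turn)"
      by (rule nn_integral_cmult) measurable
    also have "\<dots> = ?d w * (\<integral>\<^sup>+x. ennreal (1 / x) * indicator {max (cmod z) (cmod w)<..<1} x \<partial>lborel)"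
      using green_circle_mean[OF z, of w] by (cases "cmod w < 1") auto
    also have "\<dots> = (\<integral>\<^sup>+x. ?d w * (ennreal (1 / x) * indicator {max (cmod z) (cmod w)<..<1} x) \<partial>lborel)"
      by (rule nn_integral_cmult[symmetric]) measurable
    also have "\<dots> = (\<integral>\<^sup>+x. ennreal (1 / x) * indicator {cmod z<..<1} x
        * (ennreal (riesz_density r (cmod w)) * indicator (ball 0 x) w) \<partial>lborel)"
      by (intro nn_integral_cong) (auto split: split_indicator simp: mult_ac)
    finally show "(\<integral>\<^sup>+t. ?d (w * unit_pt t) * green z (w * unit_pt t) \<partial>turn)
        = (\<integral>\<^sup>+x. ennreal (1 / x) * indicator {cmod z<..<1} x
        * (ennreal (riesz_density r (cmod w)) * indicator (ball 0 x) w) \<partial>lborel)" .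
  qed
  also have "\<dots> = (\<integral>\<^sup>+x. (\<integral>\<^sup>+w. ennreal (1 / x) * indicator {cmod z<..<1} x
      * (ennreal (riesz_density r (cmod w)) * indicator (ball 0 x) w) \<partial>lborel) \<partial>lborel)"
  proof -
    have "(\<lambda>(x, w). indicator (ball 0 x) w :: ennreal) = (\<lambda>(x, w). if cmod w < x then 1 else 0)"
      by (auto simp: fun_eq_iff)
    then have [measurable]: "(\<lambda>(x, w). indicator (ball 0 x) w :: ennreal) \<in> borel_measurable (lborel \<Otimes>\<^sub>M (lborel :: complex measure))"
      by simp
    show ?thesis by (rule lborel_pair.Fubini') measurable
  qed
  also have "\<dots> = (\<integral>\<^sup>+x. ennreal ((1 - r\<^sup>2) / ((1 + r * x) * (x + r))) * indicator {cmod z<..<1} x \<partial>lborel)"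
  proof (rule nn_integral_cong)
    fix x :: real
    show "(\<integral>\<^sup>+w. ennreal (1 / x) * indicator {cmod z<..<1} x
        * (ennreal (riesz_density r (cmod w)) * indicator (ball 0 x) w) \<partial>lborel)
        = ennreal ((1 - r\<^sup>2) / ((1 + r * x) * (x + r))) * indicator {cmod z<..<1} x"
    proof (cases "cmod z < x \<and> x < 1")
      case True
      then have x: "0 < x" "x \<le> 1" by (auto intro: le_less_trans[OF norm_ge_zero])
      have [measurable]: "ball (0 :: complex) x \<in> sets borel" by simp
      have "(\<integral>\<^sup>+w. ennreal (1 / x) * indicator {cmod z<..<1} x
          * (ennreal (riesz_density r (cmod w)) * indicator (ball 0 x) w) \<partial>lborel)
          = ennreal (1 / x) * indicator {cmod z<..<1} x
          * (\<integral>\<^sup>+w. ennreal (riesz_density r (cmod w)) * indicator (ball 0 x) w \<partial>lborel)"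
        by (rule nn_integral_cmult) measurable
      also have "\<dots> = ennreal (1 / x * riesz_mass r x) * indicator {cmod z<..<1} x"
        using True x unfolding riesz_mass_of_ball[OF x] by (simp add: ennreal_mult'[symmetric])
      also have "1 / x * riesz_mass r x = (1 - r\<^sup>2) / ((1 + r * x) * (x + r))"
        using x by (simp add: riesz_mass_def)
      finally show ?thesis .
    qed auto
  qed
  also have "\<dots> = ennreal (green_inf_profile r (cmod z))"
  proof (rule nn_integral_FTC_half_open[where F="\<lambda>x. - green_inf_profile r x"])
    show "DERIV (\<lambda>x. - green_inf_profile r x) x :> (1 - r\<^sup>2) / ((1 + r * x) * (x + r))"
      if "cmod z < x" for x
      using DERIV_minus[OF green_inf_profile_deriv, of x] norm_ge_zero[of z] that by simp
    show "0 \<le> (1 - r\<^sup>2) / ((1 + r * x) * (x + r))" if "cmod z < x" for x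
      using le_less_trans[OF norm_ge_zero that] r radius_square_less_1
      by (intro divide_nonneg_nonneg mult_nonneg_nonneg add_nonneg_nonneg) auto
    have "isCont (green_inf_profile r) (cmod z)"
      by (rule DERIV_isCont[OF green_inf_profile_deriv]) simp
    then have "((\<lambda>y. ennreal (- green_inf_profile r 1 - - green_inf_profile r y))
        \<longlongrightarrow> ennreal (- green_inf_profile r 1 - - green_inf_profile r (cmod z))) (at_right (cmod z))"
      by (intro tendsto_intros isCont_tendsto_compose[of _ "green_inf_profile r"] tendsto_ident_at tendsto_ennrealI)
    then show "((\<lambda>y. ennreal (- green_inf_profile r 1 - - green_inf_profile r y))
        \<longlongrightarrow> ennreal (green_inf_profile r (cmod z))) (at_right (cmod z))"
      using r by (simp add: green_inf_profile_def add.commute)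
  qed (use z in auto)
  finally show ?thesis .
qed

text \<open>The infimum is attained at the point of the circle of radius \<open>r\<close> opposite to \<open>z\<close>. The lower bound
  comes from \<open>|1 - cnj w \<cdot> z|\<^sup>2 = |z - w|\<^sup>2 + (1 - |z|\<^sup>2) (1 - |w|\<^sup>2)\<close>, together with \<open>|z - w| \<le> |z| + r\<close> and
  \<open>|w| \<le> r\<close>.\<close>

lemma INF_green:
  assumes z: "cmod z < 1"
  shows "(INF w\<in>cball 0 r. green z w) = ennreal (green_inf_profile r (cmod z))"
proof (rule antisym)
  define u where "u = (if z = 0 then 1 else sgn z)"
  have u: "cmod u = 1" "z = of_real (cmod z) * u"
    by (auto simp: u_def sgn_eq norm_divide)
  define w where "w = - of_real r * u"
  have uu: "cnj u * u = 1" using u(1) complex_norm_square[of u] by (simp add: mult.commute)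
  have zr: "0 < cmod z + r" using r by (simp add: add_nonneg_pos)
  have "z - w = of_real (cmod z + r) * u" by (subst u(2)) (simp add: w_def algebra_simps)
  then have 1: "cmod (z - w) = cmod z + r" using u(1) zr by (simp add: norm_mult del: of_real_add)
  have "cnj w * z = - (of_real r * of_real (cmod z) * (cnj u * u))"
    by (subst u(2)) (simp add: w_def)
  then have "1 - cnj w * z = of_real (1 + r * cmod z)" by (simp add: uu)
  then have "cmod (1 - cnj w * z) = \<bar>1 + r * cmod z\<bar>" by (simp only: norm_of_real)
  then have 2: "cmod (1 - cnj w * z) = 1 + r * cmod z" using r by (simp add: add_nonneg_nonneg)
  have "w \<in> cball 0 r" using u(1) r by (simp add: w_def norm_mult)
  moreover have "green z w = ennreal (green_inf_profile r (cmod z))"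
    using 1 2 zr by (auto simp: green_def norm_divide green_inf_profile_def)
  ultimately show "(INF w\<in>cball 0 r. green z w) \<le> ennreal (green_inf_profile r (cmod z))"
    by (metis INF_lower)
next
  show "ennreal (green_inf_profile r (cmod z)) \<le> (INF w\<in>cball 0 r. green z w)"
  proof (rule INF_greatest)
    fix w :: complex assume "w \<in> cball 0 r"
    then have w: "cmod w \<le> r" by simp
    show "ennreal (green_inf_profile r (cmod z)) \<le> green z w"
    proof (cases "z = w")
      case False
      define a where "a = cmod z + r"
      have a: "0 < a" using r by (simp add: a_def add_nonneg_pos)
      have id: "(cmod (1 - cnj w * z))\<^sup>2 = (cmod (z - w))\<^sup>2 + (1 - (cmod z)\<^sup>2) * (1 - (cmod w)\<^sup>2)"
        unfolding cmod_power2 by (simp add: power2_eq_square algebra_simps)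
      have ida: "(1 + r * cmod z)\<^sup>2 = a\<^sup>2 + (1 - (cmod z)\<^sup>2) * (1 - r\<^sup>2)"
        unfolding a_def by (simp add: power2_eq_square algebra_simps)
      have "cmod (z - w) \<le> a"
        using norm_triangle_ineq4[of z w] w by (simp add: a_def)
      moreover have "(cmod w)\<^sup>2 \<le> r\<^sup>2" using w by (intro power_mono) auto
      ultimately have "(1 - r\<^sup>2) * (cmod (z - w))\<^sup>2 \<le> (1 - (cmod w)\<^sup>2) * a\<^sup>2"
        using radius_square_less_1 by (intro mult_mono power_mono) auto
      moreover have "0 \<le> 1 - (cmod z)\<^sup>2" using z by (simp add: abs_square_le_1)
      ultimately have "(1 - (cmod z)\<^sup>2) * ((1 - r\<^sup>2) * (cmod (z - w))\<^sup>2) \<le> (1 - (cmod z)\<^sup>2) * ((1 - (cmod w)\<^sup>2) * a\<^sup>2)"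
        by (rule mult_left_mono)
      then have "((1 + r * cmod z) * cmod (z - w))\<^sup>2 \<le> (cmod (1 - cnj w * z) * a)\<^sup>2"
        unfolding power_mult_distrib id ida by (simp add: algebra_simps)
      then have "(1 + r * cmod z) * cmod (z - w) \<le> cmod (1 - cnj w * z) * a"
        by (rule power2_le_imp_le) (use a in auto)
      then have "(1 + r * cmod z) / a \<le> cmod ((1 - cnj w * z) / (z - w))"
        using a False by (simp add: norm_divide divide_simps mult_ac)
      moreover have "0 < (1 + r * cmod z) / a" using a r by (simp add: add_pos_nonneg)
      ultimately have "green_inf_profile r (cmod z) \<le> ln (cmod ((1 - cnj w * z) / (z - w)))"
        unfolding green_inf_profile_def a_def by (intro ln_mono) auto
      then show ?thesis using False by (simp add: green_def ennreal_leI)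
    qed (simp add: green_def)
  qed
qed

lemma green_inf_profile_le:
  assumes "0 \<le> t" shows "green_inf_profile r t \<le> ln (1 / r)"
proof -
  have "r * r * t \<le> 1 * t" using r assms by (intro mult_right_mono mult_le_one) auto
  then have "(1 + r * t) / (t + r) \<le> 1 / r"
    using r assms by (simp add: divide_simps algebra_simps)
  moreover have "0 < (1 + r * t) / (t + r)" using r assms by (intro divide_pos_pos add_pos_nonneg add_nonneg_pos) auto
  ultimately show ?thesis unfolding green_inf_profile_def by (intro ln_mono) auto
qed

lemma sigma_green_cball: "sigma_green (cball 0 r) = riesz_measure r"
  unfolding sigma_green_def
proof (rule the_equality)
  show "disk_measure (riesz_measure r) \<and>
      (\<forall>z\<in>unit_disk. (INF w\<in>cball 0 r. green z w) = (\<integral>\<^sup>+w. green z w \<partial>riesz_measure r))"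
    using green_potential_riesz disk_measure_riesz INF_green by (auto simp: green_potential_def)
next
  fix M
  assume M: "disk_measure M \<and> (\<forall>z\<in>unit_disk. (INF w\<in>cball 0 r. green z w) = (\<integral>\<^sup>+w. green z w \<partial>M))"
  then have pot: "green_potential M z = ennreal (green_inf_profile r (cmod z))" if "cmod z < 1" for z
    using that INF_green[OF that] by (simp add: green_potential_def)
  show "M = riesz_measure r"
  proof (rule green_potential_inject)
    show "green_potential M z \<le> ennreal (ln (1 / r))" if "cmod z < 1" for z
      unfolding pot[OF that] by (intro ennreal_leI green_inf_profile_le) simp
  qed (use M in \<open>auto simp: disk_measure_riesz pot green_potential_riesz\<close>)
qed

end

section \<open>The Green equilibrium measure of a centred disc\<close>

text \<open>Subtraction on \<open>ennreal\<close> is truncated, so one of the two squares on the right vanishes and the other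
  is \<open>|a - b|\<^sup>2\<close>: this is \<open>a\<^sup>2 + b\<^sup>2 = 2 a b + |a - b|\<^sup>2\<close>, which is how an energy that may be infinite is compared with a
  finite one.\<close>

lemma ennreal_sum_of_squares:
  fixes a b :: ennreal
  assumes "b \<noteq> \<infinity>"
  shows "a * a + b * b = 2 * (a * b) + ((a - b) * (a - b) + (b - a) * (b - a))"
proof (cases a)
  case (real x)
  from assms obtain y where y: "0 \<le> y" "b = ennreal y" by (cases b) auto
  have x: "0 \<le> x" "a = ennreal x" by (rule real)+
  have "(a - b) * (a - b) + (b - a) * (b - a) = ennreal ((x - y) * (x - y))"
  proof (cases "x \<le> y")
    case True
    then have "a - b = 0" "b - a = ennreal (y - x)"
      using x y by (simp_all add: ennreal_minus ennreal_neg)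
    then have "(a - b) * (a - b) + (b - a) * (b - a) = ennreal ((y - x) * (y - x))"
      using True by (simp add: ennreal_mult)
    also have "(y - x) * (y - x) = (x - y) * (x - y)" by (simp add: algebra_simps)
    finally show ?thesis .
  next
    case False
    then have "b - a = 0" "a - b = ennreal (x - y)"
      using x y by (simp_all add: ennreal_minus ennreal_neg)
    then show ?thesis using False by (simp add: ennreal_mult)
  qed
  moreover have "a * b = ennreal (x * y)" "a * a = ennreal (x * x)" "b * b = ennreal (y * y)"
    using x y by (simp_all add: ennreal_mult)
  moreover have "ennreal (x * x) + ennreal (y * y) = ennreal (x * x + y * y)"
    by (rule ennreal_plus[symmetric]) simp_all
  moreover have "2 * ennreal (x * y) = ennreal (x * y + x * y)"
    unfolding mult_2 by (rule ennreal_plus[symmetric]) (use x y in simp_all)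
  moreover have "ennreal (x * x + y * y) = ennreal (x * y + x * y + (x - y) * (x - y))"
    by (rule arg_cong[where f=ennreal]) (simp add: algebra_simps)
  moreover have "\<dots> = ennreal (x * y + x * y) + ennreal ((x - y) * (x - y))"
    using x y by (intro ennreal_plus) auto
  ultimately show ?thesis by (simp only:)
next
  case top
  then show ?thesis using assms by (simp add: ennreal_top_mult ennreal_mult_top top_add less_top[symmetric])
qed

definition circle_measure :: "real \<Rightarrow> complex measure" where
  "circle_measure r = distr turn (restrict_space borel unit_disk) (\<lambda>t. of_real r * unit_pt t)"

lemma sigma_finite_unit_measure:
  assumes "M \<in> unit_measures_on E"
  shows "disk_measure M" "sigma_finite_measure M"
proof -
  show M: "disk_measure M" using assms by (simp add: unit_measures_on_def)
  interpret finite_measure M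
    by (rule finite_measureI) (use assms in \<open>simp add: unit_measures_on_def space_disk[OF M]\<close>)
  show "sigma_finite_measure M" by unfold_locales
qed

context
  fixes r :: real
  assumes r: "0 < r" "r < 1"
begin

lemma circle_map_measurable:
  "(\<lambda>t. of_real r * unit_pt t) \<in> turn \<rightarrow>\<^sub>M restrict_space borel unit_disk"
  using r by (intro measurable_restrict_space2) (auto simp: norm_mult)

lemma disk_measure_circle: "disk_measure (circle_measure r)"
  by (simp add: disk_measure_def circle_measure_def)

lemma nn_integral_circle:
  assumes "f \<in> borel_measurable borel"
  shows "(\<integral>\<^sup>+z. f z \<partial>circle_measure r) = (\<integral>\<^sup>+t. f (of_real r * unit_pt t) \<partial>turn)"
  unfolding circle_measure_def
  by (rule nn_integral_distr[OF circle_map_measurable])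
     (rule measurable_disk[OF disk_measure_circle assms, unfolded circle_measure_def])

lemma circle_measure_mem: "circle_measure r \<in> unit_measures_on (cball 0 r)"
proof -
  have [measurable]: "unit_disk \<in> sets (restrict_space borel unit_disk)"
    "unit_disk - cball 0 r \<in> sets (restrict_space borel unit_disk)"
    by (auto simp: sets_restrict_space_iff)
  have vimage: "(\<lambda>t. of_real r * unit_pt t) -` unit_disk = UNIV"
    "(\<lambda>t. of_real r * unit_pt t) -` (unit_disk - cball 0 r) = {}"
    using r by (auto simp: norm_mult)
  have "emeasure (circle_measure r) unit_disk = 1"
    "emeasure (circle_measure r) (unit_disk - cball 0 r) = 0"
    unfolding circle_measure_def
    by (simp_all add: emeasure_distr circle_map_measurable vimage)
  then show ?thesis by (simp add: unit_measures_on_def disk_measure_circle)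
qed

lemma green_potential_circle:
  assumes z: "cmod z < 1"
  shows "green_potential (circle_measure r) z = ennreal (ln (1 / max (cmod z) r))"
proof -
  have "green_potential (circle_measure r) z = (\<integral>\<^sup>+t. green z (of_real r * unit_pt t) \<partial>turn)"
    unfolding green_potential_def by (rule nn_integral_circle) (rule measurable_green_right)
  also have "\<dots> = (\<integral>\<^sup>+x. ennreal (1 / x) * indicator {max (cmod z) r<..<1} x \<partial>lborel)"
    using r z by (subst green_circle_mean) auto
  also have "\<dots> = ennreal (ln (1 / max (cmod z) r))"
    using r z by (intro nn_integral_inverse) auto
  finally show ?thesis .
qed

text \<open>The potential of the circle is constant on the disc that it bounds.\<close>

lemma potential_circle_integral:
  assumes M: "M \<in> unit_measures_on (cball 0 r)"
  shows "(\<integral>\<^sup>+z. green_potential (circle_measure r) z \<partial>M) = ennreal (ln (1 / r))"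
proof -
  note disk = sigma_finite_unit_measure(1)[OF M]
  have "unit_disk - cball 0 r \<in> null_sets M"
    using M by (auto simp: unit_measures_on_def null_sets_def disk_measure_def sets_restrict_space_iff)
  then have "AE z in M. z \<notin> unit_disk - cball 0 r" by (rule AE_not_in)
  then have "AE z in M. green_potential (circle_measure r) z = ennreal (ln (1 / r))"
    using AE_space
  proof eventually_elim
    case (elim z)
    then have "cmod z \<le> r" "cmod z < 1" by (auto simp: space_disk[OF disk])
    then show ?case by (simp add: green_potential_circle max_absorb2)
  qed
  then have "(\<integral>\<^sup>+z. green_potential (circle_measure r) z \<partial>M) = (\<integral>\<^sup>+z. ennreal (ln (1 / r)) \<partial>M)"
    by (rule nn_integral_cong_AE)
  also have "\<dots> = ennreal (ln (1 / r))"
    using M by (simp add: space_disk[OF disk] unit_measures_on_def)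
  finally show ?thesis .
qed

lemma energy_circle: "green_energy (circle_measure r) = ennreal (ln (1 / r))"
  unfolding green_energy_eq by (rule potential_circle_integral[OF circle_measure_mem])

text \<open>With \<open>V = ln (1 / r)\<close> and \<open>F\<close>, \<open>G\<close> the mean features of \<open>M\<close> and of the circle, \<open>\<integral> G\<^sup>2 = \<integral> F G = V\<close>, so
  \<open>\<integral> F\<^sup>2 = V + \<integral> |F - G|\<^sup>2\<close>. In the case of equality \<open>F = G\<close> almost everywhere; then the potentials agree
  everywhere, and they are bounded.\<close>

lemma energy_ge_and_rigidity:
  assumes M: "M \<in> unit_measures_on (cball 0 r)"
  shows "ennreal (ln (1 / r)) \<le> green_energy M"
    and "green_energy M = ennreal (ln (1 / r)) \<Longrightarrow> M = circle_measure r"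
proof -
  let ?\<mu> = "circle_measure r" and ?F = "mean_feature M" and ?G = "mean_feature (circle_measure r)"
  define V where "V = ennreal (ln (1 / r))"
  note M' = sigma_finite_unit_measure[OF M] and \<mu>' = sigma_finite_unit_measure[OF circle_measure_mem]
  note [measurable] = mean_feature_measurable[OF M'] mean_feature_measurable[OF \<mu>']
  have V: "V \<noteq> \<infinity>" by (simp add: V_def)
  have EM: "green_energy M = (\<integral>\<^sup>+y. ?F y * ?F y \<partial>feature_measure)"
    unfolding green_energy_eq by (rule mutual_energy_eq_feature[OF M' M'])
  have EG: "(\<integral>\<^sup>+y. ?G y * ?G y \<partial>feature_measure) = V"
    using mutual_energy_eq_feature[OF \<mu>' \<mu>'] energy_circle unfolding green_energy_eq V_def by simp
  have EMG: "(\<integral>\<^sup>+y. ?F y * ?G y \<partial>feature_measure) = V"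
    using mutual_energy_eq_feature[OF M' \<mu>'] potential_circle_integral[OF M] unfolding V_def by simp
  have "AE y in feature_measure. ?G y * ?G y \<noteq> \<infinity>"
    by (rule nn_integral_noteq_infinite) (use V EG in auto)
  then have G_fin: "AE y in feature_measure. ?G y \<noteq> \<infinity>"
    by eventually_elim (auto simp: ennreal_mult_eq_top_iff)
  define D where "D y = (?F y - ?G y) * (?F y - ?G y) + (?G y - ?F y) * (?G y - ?F y)" for y
  have [measurable]: "D \<in> borel_measurable feature_measure"
    unfolding D_def by measurable
  have "green_energy M + V = (\<integral>\<^sup>+y. ?F y * ?F y + ?G y * ?G y \<partial>feature_measure)"
    unfolding EM EG[symmetric] by (rule nn_integral_add[symmetric]) measurable
  also have "\<dots> = (\<integral>\<^sup>+y. 2 * (?F y * ?G y) + D y \<partial>feature_measure)"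
    using G_fin by (intro nn_integral_cong_AE, eventually_elim) (unfold D_def, rule ennreal_sum_of_squares)
  also have "\<dots> = 2 * V + (\<integral>\<^sup>+y. D y \<partial>feature_measure)"
    unfolding EMG[symmetric] by (simp add: nn_integral_add nn_integral_cmult)
  also have "\<dots> = V + (V + (\<integral>\<^sup>+y. D y \<partial>feature_measure))"
    by (simp add: mult_2 add.assoc)
  finally have key: "green_energy M = V + (\<integral>\<^sup>+y. D y \<partial>feature_measure)"
    using V by (simp add: add.commute[of _ V] ennreal_add_left_cancel)
  then show "ennreal (ln (1 / r)) \<le> green_energy M" by (simp add: V_def)
  assume "green_energy M = ennreal (ln (1 / r))"
  then have "V + (\<integral>\<^sup>+y. D y \<partial>feature_measure) = V + 0" using key by (simp add: V_def)
  then have "(\<integral>\<^sup>+y. D y \<partial>feature_measure) = 0" using V unfolding ennreal_add_left_cancel by auto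
  then have "AE y in feature_measure. D y = 0" by (simp add: nn_integral_0_iff_AE)
  with G_fin have FG: "AE y in feature_measure. ?F y = ?G y"
  proof eventually_elim
    case (elim y)
    then have "?F y - ?G y = 0" "?G y - ?F y = 0" by (auto simp: D_def)
    then have "?F y \<le> ?G y" "?G y \<le> ?F y" by (auto simp: diff_eq_0_iff_ennreal)
    then show ?case by simp
  qed
  have pot: "green_potential M z = green_potential ?\<mu> z" if z: "cmod z < 1" for z
    unfolding green_potential_eq_feature[OF M' z] green_potential_eq_feature[OF \<mu>' z]
    using FG by (intro nn_integral_cong_AE, eventually_elim) simp
  show "M = ?\<mu>"
  proof (rule green_potential_inject[OF M'(1) \<mu>'(1) pot])
    show "green_potential M z \<le> ennreal (ln (1 / r))" if z: "cmod z < 1" for z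
      unfolding pot[OF z] green_potential_circle[OF z]
      using r z by (intro ennreal_leI ln_mono divide_left_mono) (auto simp: less_max_iff_disj)
  qed
qed

lemma min_green_energy_cball: "min_green_energy (cball 0 r) = ennreal (ln (1 / r))"
  unfolding min_green_energy_def
proof (rule antisym)
  show "(INF M\<in>unit_measures_on (cball 0 r). green_energy M) \<le> ennreal (ln (1 / r))"
    using INF_lower[OF circle_measure_mem, of green_energy] by (simp add: energy_circle)
qed (intro INF_greatest energy_ge_and_rigidity(1))

lemma green_equilibrium_cball: "green_equilibrium (cball 0 r) = circle_measure r"
  unfolding green_equilibrium_def min_green_energy_cball
proof (rule the_equality)
  show "circle_measure r \<in> unit_measures_on (cball 0 r) \<and> green_energy (circle_measure r) = ennreal (ln (1 / r))"
    using circle_measure_mem energy_circle ..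
qed (blast intro: energy_ge_and_rigidity(2))

section \<open>The constant and the inequality\<close>

lemma INF_green_left: "cmod w < 1 \<Longrightarrow> (INF z\<in>cball 0 r. green z w) = ennreal (green_inf_profile r (cmod w))"
  unfolding green_commute[of _ w] by (rule INF_green[OF r])

lemma green_inf_profile_measurable [measurable]: "green_inf_profile r \<in> borel_measurable borel"
  unfolding green_inf_profile_def by measurable

lemma green_inf_profile_self: "green_inf_profile r r = ln ((1 + r\<^sup>2) / (2 * r))"
  by (simp add: green_inf_profile_def power2_eq_square)

lemma green_inf_profile_nonneg:
  assumes "0 \<le> t" "t \<le> 1"
  shows "0 \<le> green_inf_profile r t"
proof -
  have "0 \<le> (1 - r) * (1 - t)" using r assms by (intro mult_nonneg_nonneg) auto
  then have "t + r \<le> 1 + r * t" by (simp add: algebra_simps)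
  moreover have "0 < t + r" using r assms by (simp add: add_nonneg_pos)
  ultimately have "1 \<le> (1 + r * t) / (t + r)" by (simp add: le_divide_eq)
  then show ?thesis unfolding green_inf_profile_def by (rule ln_ge_zero)
qed

lemma green_constant_cball:
  "green_constant (cball 0 r) = ereal (ln ((1 + r\<^sup>2) / (2 * r)) + (1 - r) / (1 + r) * ln r)"
proof -
  have nonneg: "0 \<le> green_inf_profile r r"
    using r by (intro green_inf_profile_nonneg) auto
  have ln_nonneg: "0 \<le> ln (1 / r)" using r by (simp add: ln_ge_zero)
  have "(\<integral>\<^sup>+w. (INF z\<in>cball 0 r. green z w) \<partial>circle_measure r)
      = (\<integral>\<^sup>+w. ennreal (green_inf_profile r (cmod w)) \<partial>circle_measure r)"
    by (intro nn_integral_cong INF_green_left) (simp add: space_disk[OF disk_measure_circle])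
  also have "\<dots> = (\<integral>\<^sup>+t. ennreal (green_inf_profile r (cmod (of_real r * unit_pt t))) \<partial>turn)"
    by (rule nn_integral_circle) measurable
  also have "\<dots> = ennreal (green_inf_profile r r)"
    using r by (simp add: norm_mult)
  finally have "green_constant (cball 0 r)
      = ereal (green_inf_profile r r) - ereal (ln (1 / r)) * ereal ((1 - r) / (1 + r))"
    using r nonneg ln_nonneg
    unfolding green_constant_def green_equilibrium_cball min_green_energy_cball sigma_green_cball[OF r] emeasure_riesz[OF r]
    by (simp add: enn2ereal_ennreal)
  then show ?thesis
    using r by (simp add: green_inf_profile_self ln_div mult.commute)
qed

text \<open>For \<open>t \<le> r\<close> this is the monotonicity of \<open>green_inf_profile r\<close>. For \<open>t \<ge> r\<close> there is equality at \<open>t = r\<close>, and the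
  difference of the two sides increases, because \<open>t\<close> times the derivative of \<open>green_inf_profile r\<close> is at least
  \<open>- (1 - r) / (1 + r)\<close>: its absolute value is the mass \<open>riesz_mass r t\<close>, and \<open>riesz_mass r 1\<close> is the total mass.\<close>

lemma green_inf_profile_ge:
  assumes t: "0 \<le> t" "t \<le> 1"
  defines "s \<equiv> (1 - r) / (1 + r)"
  shows "green_inf_profile r r + s * ln (1 / max t r) \<le> green_inf_profile r t + s * ln (1 / r)"
proof (cases "t \<le> r")
  case True
  have "green_inf_profile r r \<le> green_inf_profile r t"
  proof (rule DERIV_nonpos_imp_nonincreasing[OF True])
    fix x assume "t \<le> x" "x \<le> r"
    then have x: "0 \<le> x" using t by simp
    have "0 \<le> (1 - r\<^sup>2) / ((1 + r * x) * (x + r))"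
      using x r radius_square_less_1[OF r] by (intro divide_nonneg_nonneg mult_nonneg_nonneg add_nonneg_nonneg) auto
    then show "\<exists>y. DERIV (green_inf_profile r) x :> y \<and> y \<le> 0"
      using green_inf_profile_deriv[OF r x] by (intro exI conjI) auto
  qed
  then show ?thesis using True by (simp add: max_absorb2)
next
  case False
  then have rt: "r \<le> t" by simp
  have "green_inf_profile r r + s * ln r \<le> green_inf_profile r t + s * ln t"
  proof (rule DERIV_nonneg_imp_nondecreasing[OF rt])
    fix x assume x: "r \<le> x" "x \<le> t"
    then have x0: "0 < x" "x \<le> 1" using r t by auto
    have pos: "0 < 1 + r * x" "0 < x + r" "0 < 1 + r" using x0 r by (auto intro: add_pos_pos)
    have "DERIV (\<lambda>x. green_inf_profile r x + s * ln x) x :> - ((1 - r\<^sup>2) / ((1 + r * x) * (x + r))) + s * (1 / x)"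
      using x0 by (auto intro!: derivative_eq_intros green_inf_profile_deriv[OF r])
    moreover have "(1 - r\<^sup>2) / ((1 + r * x) * (x + r)) \<le> s / x"
    proof -
      have "x * (1 + r)\<^sup>2 + r * (1 - x)\<^sup>2 = (1 + r * x) * (x + r)"
        by (simp add: power2_eq_square algebra_simps)
      moreover have "0 \<le> r * (1 - x)\<^sup>2" using r by simp
      \<comment> \<open>The two sides differ by \<open>r (1 - x)\<^sup>2\<close>, so the bound is sharp on the unit circle.\<close>
      ultimately have "x * (1 + r)\<^sup>2 \<le> (1 + r * x) * (x + r)" by linarith
      then have "(1 - r\<^sup>2) / ((1 + r * x) * (x + r)) \<le> (1 - r\<^sup>2) / (x * (1 + r)\<^sup>2)"
        using x0 pos radius_square_less_1[OF r] by (intro divide_left_mono) auto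
      also have "\<dots> = s / x"
      proof -
        have "1 - r\<^sup>2 = (1 - r) * (1 + r)" by (simp add: power2_eq_square algebra_simps)
        then show ?thesis using pos x0 by (simp add: s_def power2_eq_square)
      qed
      finally show ?thesis .
    qed
    ultimately show "\<exists>y. DERIV (\<lambda>x. green_inf_profile r x + s * ln x) x :> y \<and> 0 \<le> y"
      by (intro exI conjI) auto
  qed
  then show ?thesis using False r by (simp add: ln_div max_absorb1)
qed

text \<open>The inequality of the theorem with the negative part of the constant moved to the right, where
  all terms are non-negative.\<close>

lemma sum_INF_green_potential_ge:
  fixes m :: nat and \<nu> :: "nat \<Rightarrow> complex measure"
  assumes disk: "\<And>k. k \<in> {1..m} \<Longrightarrow> disk_measure (\<nu> k)"
    and mass: "(\<Sum>k=1..m. emeasure (\<nu> k) unit_disk) = 1"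
  defines "s \<equiv> (1 - r) / (1 + r)"
  shows "ennreal (green_inf_profile r r) + ennreal s * (INF z\<in>cball 0 r. (\<Sum>k=1..m. green_potential (\<nu> k) z))
    \<le> (\<Sum>k=1..m. (INF z\<in>cball 0 r. green_potential (\<nu> k) z)) + ennreal (s * ln (1 / r))"
proof -
  define h where "h w = ennreal (ln (1 / max (cmod w) r))" for w :: complex
  define p where "p w = ennreal (green_inf_profile r (cmod w))" for w :: complex
  have [measurable]: "h \<in> borel_measurable borel" "p \<in> borel_measurable borel"
    unfolding h_def p_def by measurable
  have s: "0 \<le> s" using r by (simp add: s_def)
  have nonneg: "0 \<le> green_inf_profile r r"
    using r by (intro green_inf_profile_nonneg) auto
  have sf: "sigma_finite_measure (\<nu> k)" if k: "k \<in> {1..m}" for k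
  proof -
    have "emeasure (\<nu> k) unit_disk \<le> (\<Sum>k=1..m. emeasure (\<nu> k) unit_disk)"
      using k by (intro member_le_sum) auto
    then have "emeasure (\<nu> k) unit_disk \<noteq> \<infinity>" unfolding mass by (auto simp: top_unique)
    then interpret finite_measure "\<nu> k"
      by (intro finite_measureI) (simp add: space_disk[OF disk[OF k]])
    show ?thesis by unfold_locales
  qed
  have circle_sf: "sigma_finite_measure (circle_measure r)"
    by (rule sigma_finite_unit_measure(2)[OF circle_measure_mem])
  have sum_const: "(\<Sum>k=1..m. \<integral>\<^sup>+w. c \<partial>\<nu> k) = c" for c
  proof -
    have "(\<Sum>k=1..m. \<integral>\<^sup>+w. c \<partial>\<nu> k) = (\<Sum>k=1..m. c * emeasure (\<nu> k) unit_disk)"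
      by (intro sum.cong refl) (simp add: space_disk[OF disk])
    also have "\<dots> = c" by (simp only: sum_distrib_left[symmetric] mass mult_1_right)
    finally show ?thesis .
  qed
  have mes: "f \<in> borel_measurable borel \<Longrightarrow> k \<in> {1..m} \<Longrightarrow> f \<in> borel_measurable (\<nu> k)" for f :: "complex \<Rightarrow> ennreal" and k
    by (rule measurable_disk[OF disk])

  \<comment> \<open>Taking the infimum over \<open>z\<close> inside the integral only decreases it.\<close>
  have lower: "(\<integral>\<^sup>+w. p w \<partial>\<nu> k) \<le> (INF z\<in>cball 0 r. green_potential (\<nu> k) z)" if k: "k \<in> {1..m}" for k
  proof (rule INF_greatest)
    fix z :: complex assume z: "z \<in> cball 0 r"
    show "(\<integral>\<^sup>+w. p w \<partial>\<nu> k) \<le> green_potential (\<nu> k) z"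
      unfolding green_potential_def
    proof (rule nn_integral_mono)
      fix w assume "w \<in> space (\<nu> k)"
      then have "cmod w < 1" by (simp add: space_disk[OF disk[OF k]])
      then show "p w \<le> green z w"
        unfolding p_def using INF_green_left[of w] INF_lower[OF z, of "\<lambda>z. green z w"] by simp
    qed
  qed

  \<comment> \<open>An infimum over the disc is at most the mean over its boundary circle.\<close>
  have upper: "(INF z\<in>cball 0 r. (\<Sum>k=1..m. green_potential (\<nu> k) z)) \<le> (\<Sum>k=1..m. \<integral>\<^sup>+w. h w \<partial>\<nu> k)"
  proof -
    have "(INF z\<in>cball 0 r. (\<Sum>k=1..m. green_potential (\<nu> k) z))
        = (\<integral>\<^sup>+t. (INF z\<in>cball 0 r. (\<Sum>k=1..m. green_potential (\<nu> k) z)) \<partial>turn)"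
      by simp
    also have "\<dots> \<le> (\<integral>\<^sup>+t. (\<Sum>k=1..m. green_potential (\<nu> k) (of_real r * unit_pt t)) \<partial>turn)"
      using r by (intro nn_integral_mono INF_lower) (simp add: norm_mult)
    also have "\<dots> = (\<Sum>k=1..m. \<integral>\<^sup>+w. h w \<partial>\<nu> k)"
    proof -
      have "(\<lambda>t. green_potential (\<nu> k) (of_real r * unit_pt t)) \<in> borel_measurable turn
          \<and> (\<integral>\<^sup>+t. green_potential (\<nu> k) (of_real r * unit_pt t) \<partial>turn) = (\<integral>\<^sup>+w. h w \<partial>\<nu> k)"
        if k: "k \<in> {1..m}" for k
      proof
        interpret K: sigma_finite_measure "\<nu> k" by (rule sf[OF k])
        interpret P: pair_sigma_finite turn "\<nu> k" ..
        have "(\<lambda>p. (of_real r * unit_pt (fst p), snd p)) \<in> (borel \<Otimes>\<^sub>M borel) \<rightarrow>\<^sub>M (borel \<Otimes>\<^sub>M borel)"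
          by measurable
        from measurable_compose[OF this green_measurable]
        have "(\<lambda>(t, w). green (of_real r * unit_pt t) w) \<in> borel_measurable (borel \<Otimes>\<^sub>M borel)"
          by (simp add: split_beta')
        then have m: "(\<lambda>(t, w). green (of_real r * unit_pt t) w) \<in> borel_measurable (turn \<Otimes>\<^sub>M \<nu> k)"
          by (intro measurable_pair_disk[OF disk[OF k], where B=borel]) auto
        show "(\<lambda>t. green_potential (\<nu> k) (of_real r * unit_pt t)) \<in> borel_measurable turn"
          unfolding green_potential_def by (rule K.borel_measurable_nn_integral[OF m])
        have "(\<integral>\<^sup>+t. green_potential (\<nu> k) (of_real r * unit_pt t) \<partial>turn)
            = (\<integral>\<^sup>+w. (\<integral>\<^sup>+t. green (of_real r * unit_pt t) w \<partial>turn) \<partial>\<nu> k)"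
          unfolding green_potential_def by (rule P.Fubini'[OF m, symmetric])
        also have "\<dots> = (\<integral>\<^sup>+w. h w \<partial>\<nu> k)"
        proof (rule nn_integral_cong)
          fix w assume "w \<in> space (\<nu> k)"
          then have w: "cmod w < 1" by (simp add: space_disk[OF disk[OF k]])
          have "(\<integral>\<^sup>+t. green (of_real r * unit_pt t) w \<partial>turn) = (\<integral>\<^sup>+t. green w (of_real r * unit_pt t) \<partial>turn)"
            by (simp add: green_commute[of w])
          also have "\<dots> = green_potential (circle_measure r) w"
            unfolding green_potential_def by (rule nn_integral_circle[symmetric]) (rule measurable_green_right)
          finally show "(\<integral>\<^sup>+t. green (of_real r * unit_pt t) w \<partial>turn) = h w"
            by (simp add: h_def green_potential_circle[OF w])
        qed
        finally show "(\<integral>\<^sup>+t. green_potential (\<nu> k) (of_real r * unit_pt t) \<partial>turn) = (\<integral>\<^sup>+w. h w \<partial>\<nu> k)" .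
      qed
      then show ?thesis by (subst nn_integral_sum) (auto intro!: sum.cong)
    qed
    finally show ?thesis .
  qed

  have pointwise: "ennreal (green_inf_profile r r) + ennreal s * h w \<le> p w + ennreal (s * ln (1 / r))"
    if w: "cmod w < 1" for w
  proof -
    have max: "0 < max (cmod w) r" "max (cmod w) r \<le> 1"
      using r w by (auto simp: less_max_iff_disj)
    then have ln0: "0 \<le> ln (1 / max (cmod w) r)" "0 \<le> ln (1 / r)"
      using r by (intro ln_ge_zero, simp only: le_divide_eq_1_pos)+
    have "0 \<le> green_inf_profile r (cmod w)"
      using w by (intro green_inf_profile_nonneg) auto
    moreover have "green_inf_profile r r + s * ln (1 / max (cmod w) r) \<le> green_inf_profile r (cmod w) + s * ln (1 / r)"
      unfolding s_def using w by (intro green_inf_profile_ge) auto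
    ultimately show ?thesis
      unfolding h_def p_def using nonneg s ln0
      by (simp add: ennreal_mult[symmetric] ennreal_plus[symmetric] ennreal_leI del: ennreal_plus)
  qed

  have "ennreal (green_inf_profile r r) + ennreal s * (INF z\<in>cball 0 r. (\<Sum>k=1..m. green_potential (\<nu> k) z))
      \<le> ennreal (green_inf_profile r r) + ennreal s * (\<Sum>k=1..m. \<integral>\<^sup>+w. h w \<partial>\<nu> k)"
    by (intro add_left_mono mult_left_mono upper) simp
  also have "\<dots> = (\<Sum>k=1..m. (\<integral>\<^sup>+w. ennreal (green_inf_profile r r) \<partial>\<nu> k) + ennreal s * (\<integral>\<^sup>+w. h w \<partial>\<nu> k))"
    by (simp only: sum.distrib sum_const sum_distrib_left)
  also have "\<dots> = (\<Sum>k=1..m. \<integral>\<^sup>+w. (ennreal (green_inf_profile r r) + ennreal s * h w) \<partial>\<nu> k)"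
  proof (rule sum.cong[OF refl])
    fix k assume k: "k \<in> {1..m}"
    have [measurable]: "h \<in> borel_measurable (\<nu> k)" by (rule mes[OF _ k]) measurable
    show "(\<integral>\<^sup>+w. ennreal (green_inf_profile r r) \<partial>\<nu> k) + ennreal s * (\<integral>\<^sup>+w. h w \<partial>\<nu> k)
        = (\<integral>\<^sup>+w. (ennreal (green_inf_profile r r) + ennreal s * h w) \<partial>\<nu> k)"
      by (simp add: nn_integral_add nn_integral_cmult)
  qed
  also have "\<dots> \<le> (\<Sum>k=1..m. \<integral>\<^sup>+w. (p w + ennreal (s * ln (1 / r))) \<partial>\<nu> k)"
    by (intro sum_mono nn_integral_mono pointwise) (simp add: space_disk disk)
  also have "\<dots> = (\<Sum>k=1..m. (\<integral>\<^sup>+w. p w \<partial>\<nu> k) + (\<integral>\<^sup>+w. ennreal (s * ln (1 / r)) \<partial>\<nu> k))"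
    by (intro sum.cong refl nn_integral_add mes) auto
  also have "\<dots> = (\<Sum>k=1..m. \<integral>\<^sup>+w. p w \<partial>\<nu> k) + ennreal (s * ln (1 / r))"
    by (simp only: sum.distrib sum_const)
  also have "\<dots> \<le> (\<Sum>k=1..m. (INF z\<in>cball 0 r. green_potential (\<nu> k) z)) + ennreal (s * ln (1 / r))"
    by (intro add_right_mono sum_mono lower)
  finally show ?thesis .
qed

end

theorem corollary1p3:
  fixes r :: real
  assumes "0 < r" and "r < 1"
  shows "sigma_green (cball 0 r) =
           density (restrict_space lborel unit_disk)
             (\<lambda>z. ennreal (r * (1 - r\<^sup>2) * (1 - (cmod z)\<^sup>2) /
                (2 * pi * cmod z * (r * cmod z + 1)\<^sup>2 * (r + cmod z)\<^sup>2)))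
       \<and> emeasure (sigma_green (cball 0 r)) unit_disk = ennreal ((1 - r) / (1 + r))
       \<and> (1 - r) / (1 + r) < 1
       \<and> (\<forall>(m::nat) (\<nu> :: nat \<Rightarrow> complex measure).
            (\<forall>k\<in>{1..m}. disk_measure (\<nu> k) \<and> compactly_supported (\<nu> k)) \<longrightarrow>
            (\<Sum>k=1..m. emeasure (\<nu> k) unit_disk) = 1 \<longrightarrow>
            (\<Sum>k=1..m. enn2ereal (INF z\<in>cball 0 r. green_potential (\<nu> k) z))
              \<ge> green_constant (cball 0 r)
                + enn2ereal (emeasure (sigma_green (cball 0 r)) unit_disk)
                  * enn2ereal (INF z\<in>cball 0 r. (\<Sum>k=1..m. green_potential (\<nu> k) z)))
       \<and> green_constant (cball 0 r) =
            ereal (ln ((1 + r\<^sup>2) / (2 * r)) + (1 - r) / (1 + r) * ln r)"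
proof (intro conjI allI impI)
  note r = assms
  define s where "s = (1 - r) / (1 + r)"
  show "sigma_green (cball 0 r) = density (restrict_space lborel unit_disk)
      (\<lambda>z. ennreal (r * (1 - r\<^sup>2) * (1 - (cmod z)\<^sup>2) /
        (2 * pi * cmod z * (r * cmod z + 1)\<^sup>2 * (r + cmod z)\<^sup>2)))"
    unfolding sigma_green_cball[OF r] riesz_measure_def riesz_density_def ..
  show mass: "emeasure (sigma_green (cball 0 r)) unit_disk = ennreal ((1 - r) / (1 + r))"
    unfolding sigma_green_cball[OF r] by (rule emeasure_riesz[OF r])
  show "(1 - r) / (1 + r) < 1" using r by simp
  show const: "green_constant (cball 0 r) = ereal (ln ((1 + r\<^sup>2) / (2 * r)) + (1 - r) / (1 + r) * ln r)"
    by (rule green_constant_cball[OF r])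
  fix m :: nat and \<nu> :: "nat \<Rightarrow> complex measure"
  assume \<nu>: "\<forall>k\<in>{1..m}. disk_measure (\<nu> k) \<and> compactly_supported (\<nu> k)"
    and total: "(\<Sum>k=1..m. emeasure (\<nu> k) unit_disk) = 1"
  let ?A = "\<Sum>k=1..m. (INF z\<in>cball 0 r. green_potential (\<nu> k) z)"
  let ?I = "INF z\<in>cball 0 r. (\<Sum>k=1..m. green_potential (\<nu> k) z)"
  have s: "0 \<le> s" using r by (simp add: s_def)
  have ln0: "0 \<le> ln (1 / r)" using r by (simp add: ln_ge_zero)
  have nonneg: "0 \<le> green_inf_profile r r"
    using r by (intro green_inf_profile_nonneg[OF r]) auto
  have "ennreal (green_inf_profile r r) + ennreal s * ?I \<le> ?A + ennreal (s * ln (1 / r))"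
    unfolding s_def using \<nu> total by (intro sum_INF_green_potential_ge[OF r]) auto
  then have "enn2ereal (ennreal (green_inf_profile r r) + ennreal s * ?I) \<le> enn2ereal (?A + ennreal (s * ln (1 / r)))"
    by (simp only: less_eq_ennreal.rep_eq)
  then have main: "ereal (green_inf_profile r r) + ereal s * enn2ereal ?I \<le> enn2ereal ?A + ereal (s * ln (1 / r))"
    using nonneg s ln0 by (simp add: plus_ennreal.rep_eq times_ennreal.rep_eq enn2ereal_ennreal)
  have split: "ln ((1 + r\<^sup>2) / (2 * r)) + s * ln r = green_inf_profile r r - s * ln (1 / r)"
    using r by (simp add: green_inf_profile_self[OF r] ln_div)
  have shift: "ereal (p - q) + x = (ereal p + x) - ereal q" for p q x
    by (cases x) auto
  have "ereal (green_inf_profile r r - s * ln (1 / r)) + ereal s * enn2ereal ?I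
      = (ereal (green_inf_profile r r) + ereal s * enn2ereal ?I) - ereal (s * ln (1 / r))"
    by (rule shift)
  also have "\<dots> \<le> enn2ereal ?A"
    using main by (simp add: ereal_minus_le)
  also have "enn2ereal ?A = (\<Sum>k=1..m. enn2ereal (INF z\<in>cball 0 r. green_potential (\<nu> k) z))"
    by (simp add: sum_enn2ereal)
  finally show "(\<Sum>k=1..m. enn2ereal (INF z\<in>cball 0 r. green_potential (\<nu> k) z))
      \<ge> green_constant (cball 0 r) + enn2ereal (emeasure (sigma_green (cball 0 r)) unit_disk) * enn2ereal ?I"
    unfolding const mass split s_def[symmetric] using s by (simp add: enn2ereal_ennreal)
qed

end
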